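(* Let $R$ be a ring and $R[x]$ the polynomial ring over $R$ in a central indeterminate $x$. For any left ideal $I$ of $R$, $$\sqrt[\mathrm{j}]{I[x]}=\bigl(R\cap \sqrt[\mathrm{j}]{I[x]}\,\bigr)[x].$$ Furthermore, $R\cap\sqrt[\mathrm{j}]{I[x]}$ is integral over $I$.
   Context: Rings are associative and unital, not necessarily commutative. For a left ideal $N$ of $R$, $N[x]$ denotes the left ideal of $R[x]$ consisting of the polynomials all of whose coefficients lie in $N$. For a left ideal $L$ of a ring $S$, $\sqrt[\mathrm{j}]{L}$ denotes the intersection of all maximal left ideals of $S$ containing $L$ (so it is $S$ when $L=S$); here $\sqrt[\mathrm{j}]{I[x]}$ is taken in $S=R[x]$. An element $a\in R$ is integral over a left ideal $I$ of $R$ if there exist $n\ge1$ and $r_0,\dots,r_{n-1}\in I$ with $a^n+r_{n-1}a^{n-1}+\cdots+r_1a+r_0=0$; a subset of $R$ is integral over $I$ if each of its elements is. *)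

theory Defs
  imports "HOL-Algebra.UnivPoly"
begin

text \<open>The left-sided analogues of \<^locale>\<open>ideal\<close> and \<^locale>\<open>maximalideal\<close>.\<close>

locale left_ideal = additive_subgroup I R + ring R for I and R (structure) +
  assumes left_closed: "\<lbrakk>a \<in> I; x \<in> carrier R\<rbrakk> \<Longrightarrow> x \<otimes> a \<in> I"

locale maximal_left_ideal = left_ideal +
  assumes notcarr: "carrier R \<noteq> I"
    and maximal: "\<lbrakk>left_ideal J R; I \<subseteq> J; J \<subseteq> carrier R\<rbrakk> \<Longrightarrow> J = I \<or> J = carrier R"

text \<open>The restriction to \<^term>\<open>carrier S\<close> makes the empty intersection equal to the whole ring.\<close>

definition j_radical :: "('a, 'm) ring_scheme \<Rightarrow> 'a set \<Rightarrow> 'a set" where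
  "j_radical S L = {s \<in> carrier S. \<forall>M. maximal_left_ideal M S \<and> L \<subseteq> M \<longrightarrow> s \<in> M}"

text \<open>The set \<open>N[x]\<close>. The ring \<^term>\<open>UP R\<close> does not require \<open>R\<close> to be commutative;
  its multiplication is the convolution product, so the indeterminate is central.\<close>

definition polys_over :: "('a, 'm) ring_scheme \<Rightarrow> 'a set \<Rightarrow> (nat \<Rightarrow> 'a) set" where
  "polys_over R N = {p \<in> carrier (UP R). \<forall>n. coeff (UP R) p n \<in> N}"

text \<open>The contraction \<open>R \<inter> J\<close> of a subset \<open>J\<close> of \<open>R[x]\<close>, where \<open>R\<close> is identified with
  the constant polynomials.\<close>

definition constants_in :: "('a, 'm) ring_scheme \<Rightarrow> (nat \<Rightarrow> 'a) set \<Rightarrow> 'a set" where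
  "constants_in R J = {a \<in> carrier R. monom (UP R) a 0 \<in> J}"

definition integral_elem :: "('a, 'm) ring_scheme \<Rightarrow> 'a set \<Rightarrow> 'a \<Rightarrow> bool" where
  "integral_elem R I a \<longleftrightarrow>
    (\<exists>n::nat. n \<ge> 1 \<and> (\<exists>r :: nat \<Rightarrow> 'a. (\<forall>i<n. r i \<in> I) \<and>
      a [^]\<^bsub>R\<^esub> n \<oplus>\<^bsub>R\<^esub> (\<Oplus>\<^bsub>R\<^esub>i\<in>{..<n}. r i \<otimes>\<^bsub>R\<^esub> a [^]\<^bsub>R\<^esub> i) = \<zero>\<^bsub>R\<^esub>))"

definition integral_over :: "('a, 'm) ring_scheme \<Rightarrow> 'a set \<Rightarrow> 'a set \<Rightarrow> bool" where
  "integral_over R I A \<longleftrightarrow> A \<subseteq> carrier R \<and> (\<forall>a\<in>A. integral_elem R I a)"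

end

theory Submission
  imports Defs
begin

text \<open>
  Let \<open>J\<close> be the radical of \<open>I[x]\<close>. An element \<open>s\<close> lies in \<open>J\<close> if and only if every \<open>1 - ts\<close> has a left
  inverse modulo \<open>I[x]\<close> (lemma \<open>mem_j_radical_iff\<close>). The criterion replaces maximal left
  ideals by equations, and polynomial substitutions can be applied to equations.

  That \<open>J\<close> contains every polynomial with coefficients in \<open>R \<inter> J\<close> is clear, because \<open>J\<close> is a left ideal
  and \<open>x\<close> is central. For the other inclusion, the coefficients \<open>a\<^sub>i\<close> of an element of \<open>J\<close> have to be
  isolated. Two facts about substitutions make this possible.

  \<^item> If \<open>f(x) \<in> J\<close>, then \<open>f(x\<^sup>2) \<in> J\<close> (lemma \<open>at_square_J\<close>).

  \<^item> If \<open>a g \<in> J\<close> with \<open>a \<in> R\<close> and \<open>g\<close> central and monic, then \<open>a \<in> J\<close> (lemma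
    \<open>const_J_of_const_mult_central_monic\<close>). The reason is that \<open>h(g) \<in> J\<close> implies \<open>h \<in> J\<close> when \<open>g\<close> has
    positive degree, since \<open>R[x]\<close> is free over \<open>R[g]\<close> and the projection to the coordinate at the
    basis element \<open>1\<close> carries left inverses to left inverses.

  From \<open>F = \<Sum> a\<^sub>i g\<^sub>i \<in> J\<close>, where the \<open>g\<^sub>i\<close> are central and monic of increasing degrees and \<open>h\<close> is the
  last of them, the first fact gives \<open>h(x\<^sup>2) F(x) - h(x) F(x\<^sup>2) \<in> J\<close>. The last term cancels, and the
  others keep their coefficients \<open>a\<^sub>i\<close> and get new central monic polynomials of increasing degrees.
  Iterating leaves \<open>a\<^sub>0 g\<close> with a central monic \<open>g\<close>, and the second fact gives \<open>a\<^sub>0 \<in> J\<close>; the other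
  coefficients follow by going back through the steps. The start is \<open>g\<^sub>i = x^i\<close>.

  Integrality is the criterion for \<open>s = a\<close> and \<open>t = x\<close>, read off coefficient by coefficient.
\<close>

section \<open>Left ideals and radicals of arbitrary rings\<close>

lemma (in ring) left_idealI:
  assumes "J \<subseteq> carrier R" "\<zero> \<in> J"
    and add: "\<And>a b. \<lbrakk>a \<in> J; b \<in> J\<rbrakk> \<Longrightarrow> a \<oplus> b \<in> J"
    and mult: "\<And>a x. \<lbrakk>a \<in> J; x \<in> carrier R\<rbrakk> \<Longrightarrow> x \<otimes> a \<in> J"
  shows "left_ideal J R"
proof -
  have "\<ominus> a \<in> J" if "a \<in> J" for a
  proof -
    have a: "a \<in> carrier R" using that assms(1) by blast
    have "(\<ominus> \<one>) \<otimes> a \<in> J" using mult[OF that, of "\<ominus> \<one>"] by simp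
    then show ?thesis using a by (simp add: l_minus)
  qed
  then have "additive_subgroup J R"
    using assms by unfold_locales (auto simp: a_inv_def)
  then show ?thesis
    using mult by (simp add: left_ideal_def left_ideal_axioms_def ring_axioms)
qed

context left_ideal
begin

lemma mem_carrier [simp]: "a \<in> I \<Longrightarrow> a \<in> carrier R"
  using a_subset by blast

lemma minus_mem: "\<lbrakk>a \<in> I; b \<in> I\<rbrakk> \<Longrightarrow> a \<ominus> b \<in> I"
  by (simp add: minus_eq)

lemma finsum_mem: "finite A \<Longrightarrow> (\<And>i. i \<in> A \<Longrightarrow> f i \<in> I) \<Longrightarrow> finsum R f A \<in> I"
proof (induction A rule: finite_induct)
  case (insert x F)
  then show ?case by (subst finsum_insert) (auto simp: Pi_def)
qed simp

text \<open>The enlargement of a left ideal by one element, against which maximality is tested.\<close>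

lemma left_ideal_plus_principal:
  assumes z: "z \<in> carrier R"
  shows "left_ideal {y \<oplus> u \<otimes> z | y u. y \<in> I \<and> u \<in> carrier R} R" (is "left_ideal ?N R")
    and "I \<subseteq> {y \<oplus> u \<otimes> z | y u. y \<in> I \<and> u \<in> carrier R}"
    and "z \<in> {y \<oplus> u \<otimes> z | y u. y \<in> I \<and> u \<in> carrier R}"
proof -
  show "left_ideal ?N R"
  proof (rule left_idealI)
    show "?N \<subseteq> carrier R" using z by auto
    show "\<zero> \<in> ?N" using z by (auto intro!: exI[of _ \<zero>])
  next
    fix a b assume "a \<in> ?N" "b \<in> ?N"
    then obtain y u y' u' where *: "y \<in> I" "u \<in> carrier R" "y' \<in> I" "u' \<in> carrier R"
      and a: "a = y \<oplus> u \<otimes> z" and b: "b = y' \<oplus> u' \<otimes> z"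
      by blast
    have "a \<oplus> b = (y \<oplus> y') \<oplus> (u \<oplus> u') \<otimes> z"
      unfolding a b using * z by (simp add: l_distr a_ac)
    then show "a \<oplus> b \<in> ?N" using * by blast
  next
    fix a x assume "a \<in> ?N" and x: "x \<in> carrier R"
    then obtain y u where *: "y \<in> I" "u \<in> carrier R" and a: "a = y \<oplus> u \<otimes> z"
      by blast
    have "x \<otimes> a = x \<otimes> y \<oplus> (x \<otimes> u) \<otimes> z"
      unfolding a using * x z by (simp add: r_distr m_assoc)
    then show "x \<otimes> a \<in> ?N" using * x left_closed by blast
  qed
  show "I \<subseteq> ?N"
  proof
    fix y assume "y \<in> I"
    then have "y = y \<oplus> \<zero> \<otimes> z" using z by simp
    then show "y \<in> ?N" using \<open>y \<in> I\<close> by blast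
  qed
  have "z = \<zero> \<oplus> \<one> \<otimes> z" using z by simp
  then show "z \<in> ?N" using additive_subgroup.zero_closed[OF is_additive_subgroup] one_closed by blast
qed

lemma ex_maximal_left_ideal:
  assumes one: "\<one> \<notin> I"
  shows "\<exists>M. maximal_left_ideal M R \<and> I \<subseteq> M"
proof -
  let ?A = "{J. left_ideal J R \<and> I \<subseteq> J \<and> \<one> \<notin> J}"
  have "\<exists>M\<in>?A. \<forall>J\<in>?A. M \<subseteq> J \<longrightarrow> J = M"
  proof (rule subset_Zorn_nonempty)
    show "?A \<noteq> {}" using one left_ideal_axioms by blast
  next
    fix Ch assume ne: "Ch \<noteq> {}" and ch: "subset.chain ?A Ch"
    have sub: "\<And>J. J \<in> Ch \<Longrightarrow> left_ideal J R \<and> I \<subseteq> J \<and> \<one> \<notin> J"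
      using ch by (auto simp: subset_chain_def)
    have tot: "\<And>J K. J \<in> Ch \<Longrightarrow> K \<in> Ch \<Longrightarrow> J \<subseteq> K \<or> K \<subseteq> J"
      using ch by (auto simp: subset_chain_def)
    have "left_ideal (\<Union>Ch) R"
    proof (rule left_idealI)
      show "\<Union>Ch \<subseteq> carrier R"
        using left_ideal.mem_carrier sub by (metis Union_least subsetI)
      obtain J where J: "J \<in> Ch" using ne by blast
      interpret J: left_ideal J R using sub J by blast
      show "\<zero> \<in> \<Union>Ch" using J additive_subgroup.zero_closed[OF J.is_additive_subgroup] by blast
    next
      fix a b assume "a \<in> \<Union>Ch" "b \<in> \<Union>Ch"
      then obtain J where J: "J \<in> Ch" "a \<in> J" "b \<in> J" using tot by blast
      then interpret J: left_ideal J R using sub by blast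
      show "a \<oplus> b \<in> \<Union>Ch" using J by auto
    next
      fix a x assume "a \<in> \<Union>Ch" "x \<in> carrier R"
      then obtain J where J: "J \<in> Ch" "a \<in> J" by blast
      then interpret J: left_ideal J R using sub by blast
      show "x \<otimes> a \<in> \<Union>Ch" using J J.left_closed \<open>x \<in> carrier R\<close> by blast
    qed
    moreover have "I \<subseteq> \<Union>Ch" using ne sub by (meson Union_upper equals0I order_trans)
    moreover have "\<one> \<notin> \<Union>Ch" using sub by blast
    ultimately show "\<Union>Ch \<in> ?A" by simp
  qed
  then obtain M where MA: "M \<in> ?A" and maxA: "\<forall>J\<in>?A. M \<subseteq> J \<longrightarrow> J = M"
    by (elim bexE)
  from MA have M: "left_ideal M R" "I \<subseteq> M" "\<one> \<notin> M"
    by simp_all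
  have max: "J = M" if "left_ideal J R" "I \<subseteq> J" "\<one> \<notin> J" "M \<subseteq> J" for J
    using maxA that by simp
  have "maximal_left_ideal M R"
  proof (intro maximal_left_ideal.intro maximal_left_ideal_axioms.intro M(1))
    show "carrier R \<noteq> M" using M(3) by auto
  next
    fix J assume J: "left_ideal J R" "M \<subseteq> J" "J \<subseteq> carrier R"
    show "J = M \<or> J = carrier R"
    proof (cases "\<one> \<in> J")
      case True
      have "x \<in> J" if "x \<in> carrier R" for x
        using left_ideal.left_closed[OF J(1) True that] that by simp
      then show ?thesis using J(3) by blast
    next
      case False
      then show ?thesis using max[OF J(1) order_trans[OF M(2) J(2)] False J(2)] by simp
    qed
  qed
  then show ?thesis using M(2) by blast
qed

text \<open>Membership in the radical becomes a solvability condition, the left-ideal form of left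
  quasi-regularity, which polynomial substitutions can transport. If \<open>1 - ts\<close> had no left inverse
  modulo \<open>I\<close>, then \<open>I\<close> and \<open>1 - ts\<close> would lie in a common maximal left ideal, which would contain
  \<open>s\<close> and hence \<open>1\<close>. Conversely, if a maximal left ideal \<open>M\<close> above \<open>I\<close> misses \<open>s\<close>, then
  \<open>1 - ts\<close> lies in \<open>M\<close> for some \<open>t\<close>, so it cannot have such an inverse.\<close>

lemma mem_j_radical_iff:
  "s \<in> j_radical R I \<longleftrightarrow> s \<in> carrier R \<and>
    (\<forall>t\<in>carrier R. \<exists>u\<in>carrier R. \<exists>y\<in>I. u \<otimes> (\<one> \<ominus> t \<otimes> s) = \<one> \<oplus> y)"
proof (intro iffI conjI ballI)
  assume "s \<in> j_radical R I"
  then have s: "s \<in> carrier R"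
    and inM: "\<And>M. maximal_left_ideal M R \<Longrightarrow> I \<subseteq> M \<Longrightarrow> s \<in> M"
    by (auto simp: j_radical_def)
  show "s \<in> carrier R" by (rule s)
  fix t assume t: "t \<in> carrier R"
  define z where "z = \<one> \<ominus> t \<otimes> s"
  have z: "z \<in> carrier R" using s t by (simp add: z_def)
  let ?N = "{y \<oplus> u \<otimes> z | y u. y \<in> I \<and> u \<in> carrier R}"
  note N = left_ideal_plus_principal[OF z]
  have "\<one> \<in> ?N"
  proof (rule ccontr)
    assume "\<one> \<notin> ?N"
    from left_ideal.ex_maximal_left_ideal[OF N(1) this]
    obtain M where M: "maximal_left_ideal M R" "?N \<subseteq> M" by (elim exE conjE)
    interpret M: maximal_left_ideal M R by (rule M(1))
    have "s \<in> M" by (rule inM[OF M(1) order_trans[OF N(2) M(2)]])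
    then have "t \<otimes> s \<in> M" using t by (rule M.left_closed)
    moreover have "z \<in> M" by (rule subsetD[OF M(2) N(3)])
    ultimately have "z \<oplus> t \<otimes> s \<in> M" by simp
    moreover have "z \<oplus> t \<otimes> s = \<one>"
      using s t by (simp add: z_def minus_eq a_assoc l_neg)
    ultimately have one: "\<one> \<in> M" by simp
    have "x \<in> M" if "x \<in> carrier R" for x
      using M.left_closed[OF one that] that by simp
    then show False using M.notcarr M.a_subset by blast
  qed
  then obtain y u where y: "y \<in> I" and u: "u \<in> carrier R" and 1: "\<one> = y \<oplus> u \<otimes> z"
    unfolding mem_Collect_eq by (elim exE conjE)
  have "u \<otimes> z = (y \<oplus> u \<otimes> z) \<oplus> \<ominus> y"
    using y u z by (simp add: a_ac r_neg2)
  then have "u \<otimes> z = \<one> \<oplus> \<ominus> y" by (simp only: 1[symmetric])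
  then show "\<exists>u\<in>carrier R. \<exists>y\<in>I. u \<otimes> (\<one> \<ominus> t \<otimes> s) = \<one> \<oplus> y"
    using u additive_subgroup.a_inv_closed[OF is_additive_subgroup y] unfolding z_def by (intro bexI)
next
  assume *: "s \<in> carrier R \<and>
    (\<forall>t\<in>carrier R. \<exists>u\<in>carrier R. \<exists>y\<in>I. u \<otimes> (\<one> \<ominus> t \<otimes> s) = \<one> \<oplus> y)"
  then have s: "s \<in> carrier R" by blast
  have "s \<in> M" if M: "maximal_left_ideal M R" "I \<subseteq> M" for M
  proof (rule ccontr)
    assume sM: "s \<notin> M"
    interpret M: maximal_left_ideal M R by (rule M(1))
    let ?N = "{y \<oplus> u \<otimes> s | y u. y \<in> M \<and> u \<in> carrier R}"
    note N = M.left_ideal_plus_principal[OF s]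
    have "?N \<subseteq> carrier R" using s by auto
    then have "?N = M \<or> ?N = carrier R"
      by (rule M.maximal[OF N(1,2)])
    moreover have "?N \<noteq> M" using sM by (rule contrapos_nn) (use N(3) in \<open>simp only:\<close>)
    ultimately have "?N = carrier R" by (elim disjE) (erule notE)
    then have "\<one> \<in> ?N" by simp
    then obtain m t where m: "m \<in> M" and t: "t \<in> carrier R" and 1: "\<one> = m \<oplus> t \<otimes> s"
      unfolding mem_Collect_eq by (elim exE conjE)
    obtain u y where u: "u \<in> carrier R" and y: "y \<in> I" and uy: "u \<otimes> (\<one> \<ominus> t \<otimes> s) = \<one> \<oplus> y"
      using * t by meson
    have "(m \<oplus> t \<otimes> s) \<ominus> t \<otimes> s = m"
      using m t s by (simp add: minus_eq a_assoc r_neg)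
    then have "u \<otimes> m = \<one> \<oplus> y" using uy by (simp only: 1[symmetric])
    then have "(\<one> \<oplus> y) \<ominus> y \<in> M"
      using M.left_closed[OF m u] y M(2) M.minus_mem by auto
    moreover have "(\<one> \<oplus> y) \<ominus> y = \<one>" using y by (simp add: minus_eq a_assoc r_neg)
    ultimately have one: "\<one> \<in> M" by simp
    have "x \<in> M" if "x \<in> carrier R" for x
      using M.left_closed[OF one that] that by simp
    then show False using M.notcarr M.a_subset by blast
  qed
  then show "s \<in> j_radical R I" using s by (auto simp: j_radical_def)
qed

lemma left_ideal_j_radical: "left_ideal (j_radical R I) R"
proof (rule left_idealI)
  show "j_radical R I \<subseteq> carrier R" by (auto simp: j_radical_def)
  have sub: "additive_subgroup M R" if "maximal_left_ideal M R" for M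
    using that by (simp add: maximal_left_ideal_def left_ideal_def)
  show "\<zero> \<in> j_radical R I"
    using additive_subgroup.zero_closed[OF sub] by (simp add: j_radical_def)
  show "a \<oplus> b \<in> j_radical R I" if "a \<in> j_radical R I" "b \<in> j_radical R I" for a b
    using that additive_subgroup.a_closed[OF sub] by (simp add: j_radical_def)
  show "x \<otimes> a \<in> j_radical R I" if "a \<in> j_radical R I" "x \<in> carrier R" for a x
  proof -
    have "x \<otimes> a \<in> M" if "maximal_left_ideal M R" "I \<subseteq> M" for M
    proof (rule left_ideal.left_closed[OF maximal_left_ideal.axioms(1)])
      show "a \<in> M" using that \<open>a \<in> j_radical R I\<close> by (simp add: j_radical_def)
    qed fact+
    then show ?thesis using that by (simp add: j_radical_def)
  qed
qed

end

text \<open>Only central polynomials may replace the powers of the indeterminate below, since the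
  coefficients have to commute past them from both sides.\<close>

definition ring_center :: "('a, 'm) ring_scheme \<Rightarrow> 'a set" where
  "ring_center R = {z \<in> carrier R. \<forall>s\<in>carrier R. z \<otimes>\<^bsub>R\<^esub> s = s \<otimes>\<^bsub>R\<^esub> z}"

context ring
begin

lemma center_closed: "z \<in> ring_center R \<Longrightarrow> z \<in> carrier R"
  by (simp add: ring_center_def)

lemma center_comm: "\<lbrakk>z \<in> ring_center R; s \<in> carrier R\<rbrakk> \<Longrightarrow> z \<otimes> s = s \<otimes> z"
  unfolding ring_center_def by blast

lemma center_zero: "\<zero> \<in> ring_center R"
  and center_one: "\<one> \<in> ring_center R"
  by (simp_all add: ring_center_def)

lemma centerI: "\<lbrakk>z \<in> carrier R; \<And>s. s \<in> carrier R \<Longrightarrow> z \<otimes> s = s \<otimes> z\<rbrakk> \<Longrightarrow> z \<in> ring_center R"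
  unfolding ring_center_def by blast

\<comment> \<open>A rewrite rule only from here on: together with the unfolded definition of the centre it would
  send the simplifier into a loop.\<close>
declare center_closed [simp]

lemma center_add:
  assumes "y \<in> ring_center R" "z \<in> ring_center R"
  shows "y \<oplus> z \<in> ring_center R"
proof (rule centerI)
  fix s assume s: "s \<in> carrier R"
  show "(y \<oplus> z) \<otimes> s = s \<otimes> (y \<oplus> z)"
    using assms s center_comm[OF assms(1) s] center_comm[OF assms(2) s]
    by (simp only: l_distr r_distr center_closed)
qed (use assms in simp)

lemma center_minus:
  assumes "y \<in> ring_center R" "z \<in> ring_center R"
  shows "y \<ominus> z \<in> ring_center R"
proof (rule centerI)
  fix s assume s: "s \<in> carrier R"
  show "(y \<ominus> z) \<otimes> s = s \<otimes> (y \<ominus> z)"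
    using assms s center_comm[OF assms(1) s] center_comm[OF assms(2) s]
    by (simp only: l_distr r_distr center_closed minus_eq l_minus r_minus a_inv_closed)
qed (use assms in simp)

lemma center_mult:
  assumes "y \<in> ring_center R" "z \<in> ring_center R"
  shows "y \<otimes> z \<in> ring_center R"
proof (rule centerI)
  fix s assume s: "s \<in> carrier R"
  have "(y \<otimes> z) \<otimes> s = y \<otimes> (z \<otimes> s)" using assms s by (simp add: m_assoc)
  also have "\<dots> = (y \<otimes> s) \<otimes> z"
    unfolding center_comm[OF assms(2) s] using assms s by (simp add: m_assoc)
  also have "\<dots> = s \<otimes> (y \<otimes> z)"
    unfolding center_comm[OF assms(1) s] using assms s by (simp add: m_assoc)
  finally show "(y \<otimes> z) \<otimes> s = s \<otimes> (y \<otimes> z)" .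
qed (use assms in simp)

lemma center_finsum:
  "finite A \<Longrightarrow> (\<And>i. i \<in> A \<Longrightarrow> f i \<in> ring_center R) \<Longrightarrow> finsum R f A \<in> ring_center R"
proof (induction A rule: finite_induct)
  case (insert x F)
  then show ?case by (subst finsum_insert) (simp_all add: Pi_def center_add)
qed (simp add: center_zero)

end

section \<open>Replacing the powers of the indeterminate\<close>

context UP_ring
begin

abbreviation const :: "'a \<Rightarrow> nat \<Rightarrow> 'a" where
  "const a \<equiv> monom P a 0"

definition indet :: "nat \<Rightarrow> 'a" where
  "indet = monom P \<one> 1"

lemma indet_closed [simp]: "indet \<in> carrier P"
  by (simp add: indet_def)

lemma coeff_const_mult: "\<lbrakk>a \<in> carrier R; p \<in> carrier P\<rbrakk> \<Longrightarrow> coeff P (const a \<otimes>\<^bsub>P\<^esub> p) n = a \<otimes> coeff P p n"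
  by (simp add: monom_mult_is_smult)

lemma coeff_mult_const:
  assumes "p \<in> carrier P" "b \<in> carrier R"
  shows "coeff P (p \<otimes>\<^bsub>P\<^esub> const b) n = coeff P p n \<otimes> b"
proof -
  have "coeff P (p \<otimes>\<^bsub>P\<^esub> const b) n = (\<Oplus>i\<in>{..n}. if n = i then coeff P p i \<otimes> b else \<zero>)"
    using assms by (auto intro!: R.finsum_cong' simp: Pi_def)
  also have "\<dots> = coeff P p n \<otimes> b"
    using assms by (subst R.finsum_singleton) auto
  finally show ?thesis .
qed

lemma coeff_mult_indet:
  assumes "p \<in> carrier P"
  shows "coeff P (p \<otimes>\<^bsub>P\<^esub> indet) n = (case n of 0 \<Rightarrow> \<zero> | Suc m \<Rightarrow> coeff P p m)"
proof (cases n)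
  case 0
  then show ?thesis using assms by (simp add: indet_def)
next
  case (Suc m)
  have "coeff P (p \<otimes>\<^bsub>P\<^esub> indet) n = (\<Oplus>i\<in>{..n}. if m = i then coeff P p i else \<zero>)"
    using assms Suc by (auto intro!: R.finsum_cong' simp: Pi_def indet_def)
  also have "\<dots> = coeff P p m"
    using assms Suc by (subst R.finsum_singleton) auto
  finally show ?thesis using Suc by simp
qed

lemma coeff_indet_mult:
  assumes "p \<in> carrier P"
  shows "coeff P (indet \<otimes>\<^bsub>P\<^esub> p) n = (case n of 0 \<Rightarrow> \<zero> | Suc m \<Rightarrow> coeff P p m)"
proof (cases n)
  case 0
  then show ?thesis using assms by (simp add: indet_def)
next
  case (Suc m)
  have "coeff P (indet \<otimes>\<^bsub>P\<^esub> p) n = (\<Oplus>i\<in>{..n}. if 1 = i then coeff P p (n - i) else \<zero>)"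
    using assms Suc by (auto intro!: R.finsum_cong' simp: Pi_def indet_def)
  also have "\<dots> = coeff P p m"
    using assms Suc by (subst R.finsum_singleton) auto
  finally show ?thesis using Suc by simp
qed

lemma indet_center: "indet \<in> ring_center P"
proof (rule P.centerI)
  show "indet \<otimes>\<^bsub>P\<^esub> p = p \<otimes>\<^bsub>P\<^esub> indet" if "p \<in> carrier P" for p
    using that by (intro up_eqI) (simp_all only: coeff_mult_indet coeff_indet_mult UP_mult_closed indet_closed)
qed simp

lemma const_mult: "\<lbrakk>a \<in> carrier R; b \<in> carrier R\<rbrakk> \<Longrightarrow> const (a \<otimes> b) = const a \<otimes>\<^bsub>P\<^esub> const b"
  using monom_mult[of a b 0 0] by simp

lemma const_center:
  assumes a: "a \<in> ring_center R"
  shows "const a \<in> ring_center P"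
proof (rule P.centerI)
  show "const a \<otimes>\<^bsub>P\<^esub> p = p \<otimes>\<^bsub>P\<^esub> const a" if p: "p \<in> carrier P" for p
    using a p R.center_comm[OF a] by (intro up_eqI) (simp_all add: coeff_const_mult coeff_mult_const del: coeff_mult)
qed (use a in simp)

lemma coeff_center:
  assumes g: "g \<in> ring_center P"
  shows "coeff P g n \<in> ring_center R"
proof (rule R.centerI)
  show "coeff P g n \<otimes> a = a \<otimes> coeff P g n" if a: "a \<in> carrier R" for a
    using arg_cong[OF P.center_comm[OF g monom_closed[OF a, of 0]], of "\<lambda>q. coeff P q n"] a g
    by (simp add: coeff_const_mult coeff_mult_const del: coeff_mult)
qed (use g in simp)

lemma split_const_term:
  assumes p: "p \<in> carrier P"
  obtains q where "q \<in> carrier P" "p = const (coeff P p 0) \<oplus>\<^bsub>P\<^esub> q \<otimes>\<^bsub>P\<^esub> indet"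
    "\<And>n. coeff P q n = coeff P p (Suc n)"
proof -
  define q where "q = (\<lambda>n. coeff P p (Suc n))"
  have "q \<in> up R"
  proof (rule mem_upI)
    show "\<exists>n. bound \<zero> n q"
      using deg_aboveD[OF _ p] by (intro exI[of _ "deg R p"] bound.intro) (simp add: q_def)
  qed (use p in \<open>simp add: q_def\<close>)
  then have q: "q \<in> carrier P" and cq: "\<And>n. coeff P q n = coeff P p (Suc n)"
    by (simp_all add: P_def UP_def q_def)
  have "p = const (coeff P p 0) \<oplus>\<^bsub>P\<^esub> q \<otimes>\<^bsub>P\<^esub> indet"
  proof (rule up_eqI)
    show "coeff P p n = coeff P (const (coeff P p 0) \<oplus>\<^bsub>P\<^esub> q \<otimes>\<^bsub>P\<^esub> indet) n" for n
      using p q by (cases n) (simp_all add: coeff_mult_indet cq del: coeff_mult)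
  qed (use p q in simp_all)
  then show thesis using that q cq by blast
qed

lemma poly_induct [consumes 1, case_names zero step]:
  assumes p: "p \<in> carrier P"
    and zero: "Q \<zero>\<^bsub>P\<^esub>"
    and step: "\<And>a q. \<lbrakk>a \<in> carrier R; q \<in> carrier P; Q q\<rbrakk> \<Longrightarrow> Q (const a \<oplus>\<^bsub>P\<^esub> q \<otimes>\<^bsub>P\<^esub> indet)"
  shows "Q p"
proof -
  have "Q p" if "p \<in> carrier P" "\<And>m. m \<ge> n \<Longrightarrow> coeff P p m = \<zero>" for n
    using that
  proof (induction n arbitrary: p)
    case 0
    then have "p = \<zero>\<^bsub>P\<^esub>" by (intro up_eqI) simp_all
    then show ?case using zero by simp
  next
    case (Suc n)
    obtain q where q: "q \<in> carrier P" "p = const (coeff P p 0) \<oplus>\<^bsub>P\<^esub> q \<otimes>\<^bsub>P\<^esub> indet"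
      and cq: "\<And>n. coeff P q n = coeff P p (Suc n)"
      using split_const_term[OF Suc.prems(1)] by blast
    have "Q q" using q(1) Suc.prems(2) by (intro Suc.IH) (simp_all add: cq)
    then have "Q (const (coeff P p 0) \<oplus>\<^bsub>P\<^esub> q \<otimes>\<^bsub>P\<^esub> indet)"
      using q(1) Suc.prems(1) by (intro step) simp_all
    then show ?case using q(2) by simp
  qed
  from this[OF p, of "Suc (deg R p)"] show ?thesis
    using deg_aboveD[OF _ p] by simp
qed

text \<open>The map \<open>\<Sum> a\<^sub>i x^i \<mapsto> \<Sum> a\<^sub>i c\<^sub>i\<close>. It is additive, and linear over the constants on both sides
  when all \<open>c\<^sub>i\<close> are central. Substitution of a central polynomial is the case of a sequence of
  powers; the coordinate maps used for monic polynomials are another case.\<close>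

definition replace_powers :: "(nat \<Rightarrow> nat \<Rightarrow> 'a) \<Rightarrow> (nat \<Rightarrow> 'a) \<Rightarrow> nat \<Rightarrow> 'a" where
  "replace_powers c p = (\<Oplus>\<^bsub>P\<^esub>i\<in>{..deg R p}. const (coeff P p i) \<otimes>\<^bsub>P\<^esub> c i)"

lemma replace_powers_atMost:
  assumes c: "\<And>i. c i \<in> carrier P" and p: "p \<in> carrier P" and n: "deg R p \<le> n"
  shows "replace_powers c p = (\<Oplus>\<^bsub>P\<^esub>i\<in>{..n}. const (coeff P p i) \<otimes>\<^bsub>P\<^esub> c i)"
  using n
proof (induction n rule: dec_induct)
  case base
  then show ?case by (simp add: replace_powers_def)
next
  case (step n)
  have "coeff P p (Suc n) = \<zero>" using step p by (intro deg_aboveD) simp_all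
  then show ?case using step c p by (simp add: Pi_def)
qed

lemma replace_powers_closed [simp]:
  "\<lbrakk>\<And>i. c i \<in> carrier P; p \<in> carrier P\<rbrakk> \<Longrightarrow> replace_powers c p \<in> carrier P"
  by (simp add: replace_powers_def Pi_def)

lemma replace_powers_zero:
  assumes "\<And>i. c i \<in> carrier P"
  shows "replace_powers c \<zero>\<^bsub>P\<^esub> = \<zero>\<^bsub>P\<^esub>"
  using assms by (simp add: replace_powers_def)

lemma replace_powers_add:
  assumes c: "\<And>i. c i \<in> carrier P" and p: "p \<in> carrier P" and q: "q \<in> carrier P"
  shows "replace_powers c (p \<oplus>\<^bsub>P\<^esub> q) = replace_powers c p \<oplus>\<^bsub>P\<^esub> replace_powers c q"
proof -
  let ?n = "max (deg R p) (deg R q)"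
  have "replace_powers c (p \<oplus>\<^bsub>P\<^esub> q)
      = (\<Oplus>\<^bsub>P\<^esub>i\<in>{..?n}. const (coeff P p i) \<otimes>\<^bsub>P\<^esub> c i \<oplus>\<^bsub>P\<^esub> const (coeff P q i) \<otimes>\<^bsub>P\<^esub> c i)"
    using c p q by (subst replace_powers_atMost[where n = ?n]) (simp_all add: P.l_distr)
  also have "\<dots> = replace_powers c p \<oplus>\<^bsub>P\<^esub> replace_powers c q"
    using c p q by (simp add: P.finsum_addf replace_powers_atMost[where n = ?n] Pi_def)
  finally show ?thesis .
qed

lemma replace_powers_step:
  assumes c: "\<And>i. c i \<in> carrier P" and a: "a \<in> carrier R" and q: "q \<in> carrier P"
  shows "replace_powers c (const a \<oplus>\<^bsub>P\<^esub> q \<otimes>\<^bsub>P\<^esub> indet)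
    = const a \<otimes>\<^bsub>P\<^esub> c 0 \<oplus>\<^bsub>P\<^esub> replace_powers (\<lambda>i. c (Suc i)) q"
proof -
  let ?p = "const a \<oplus>\<^bsub>P\<^esub> q \<otimes>\<^bsub>P\<^esub> indet"
  have p: "?p \<in> carrier P" using a q by simp
  have cf: "coeff P ?p 0 = a" "\<And>n. coeff P ?p (Suc n) = coeff P q n"
    using a q by (simp_all add: coeff_mult_indet del: coeff_mult)
  have "deg R ?p \<le> Suc (deg R q)"
  proof (rule deg_aboveI[OF _ p])
    show "coeff P ?p m = \<zero>" if "Suc (deg R q) < m" for m
      using that q cf(2) by (cases m) (simp_all add: deg_aboveD)
  qed
  then have "replace_powers c ?p = (\<Oplus>\<^bsub>P\<^esub>i\<in>{..Suc (deg R q)}. const (coeff P ?p i) \<otimes>\<^bsub>P\<^esub> c i)"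
    using c p by (intro replace_powers_atMost)
  also have "\<dots> = (\<Oplus>\<^bsub>P\<^esub>i\<in>{..deg R q}. const (coeff P ?p (Suc i)) \<otimes>\<^bsub>P\<^esub> c (Suc i)) \<oplus>\<^bsub>P\<^esub> const (coeff P ?p 0) \<otimes>\<^bsub>P\<^esub> c 0"
    using c p by (intro P.finsum_Suc2) (simp add: Pi_def del: coeff_add)
  also have "\<dots> = const a \<otimes>\<^bsub>P\<^esub> c 0 \<oplus>\<^bsub>P\<^esub> replace_powers (\<lambda>i. c (Suc i)) q"
    unfolding cf using c q a by (simp add: replace_powers_def P.a_comm Pi_def)
  finally show ?thesis .
qed

lemma replace_powers_const:
  assumes c: "\<And>i. c i \<in> carrier P" and a: "a \<in> carrier R"
  shows "replace_powers c (const a) = const a \<otimes>\<^bsub>P\<^esub> c 0"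
  using replace_powers_step[OF c a, of "\<zero>\<^bsub>P\<^esub>"] a c by (simp add: replace_powers_zero)

lemma replace_powers_mult_indet:
  assumes c: "\<And>i. c i \<in> carrier P" and q: "q \<in> carrier P"
  shows "replace_powers c (q \<otimes>\<^bsub>P\<^esub> indet) = replace_powers (\<lambda>i. c (Suc i)) q"
  using replace_powers_step[OF c R.zero_closed q] c q by simp

lemma replace_powers_minus:
  assumes c: "\<And>i. c i \<in> carrier P" and p: "p \<in> carrier P" and q: "q \<in> carrier P"
  shows "replace_powers c (p \<ominus>\<^bsub>P\<^esub> q) = replace_powers c p \<ominus>\<^bsub>P\<^esub> replace_powers c q"
proof -
  have "(p \<ominus>\<^bsub>P\<^esub> q) \<oplus>\<^bsub>P\<^esub> q = p"
    using p q by (simp add: P.minus_eq P.a_assoc P.l_neg)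
  then have "replace_powers c p = replace_powers c (p \<ominus>\<^bsub>P\<^esub> q) \<oplus>\<^bsub>P\<^esub> replace_powers c q"
    using replace_powers_add[OF c P.minus_closed[OF p q] q] by simp
  then show ?thesis using c p q by (simp add: P.minus_eq P.a_assoc P.r_neg)
qed

lemma replace_powers_rmult:
  assumes p: "p \<in> carrier P" and g: "g \<in> carrier P" and c: "\<And>i. c i \<in> carrier P"
  shows "replace_powers (\<lambda>i. c i \<otimes>\<^bsub>P\<^esub> g) p = replace_powers c p \<otimes>\<^bsub>P\<^esub> g"
proof -
  have "replace_powers c p \<otimes>\<^bsub>P\<^esub> g = (\<Oplus>\<^bsub>P\<^esub>i\<in>{..deg R p}. const (coeff P p i) \<otimes>\<^bsub>P\<^esub> c i \<otimes>\<^bsub>P\<^esub> g)"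
    unfolding replace_powers_def using p c g by (subst P.finsum_ldistr) (simp_all add: Pi_def)
  also have "\<dots> = replace_powers (\<lambda>i. c i \<otimes>\<^bsub>P\<^esub> g) p"
    unfolding replace_powers_def
    by (intro P.finsum_cong') (use p c g in \<open>simp_all add: Pi_def P.m_assoc\<close>)
  finally show ?thesis by simp
qed

lemma replace_powers_add_family:
  assumes p: "p \<in> carrier P" and c: "\<And>i. c i \<in> carrier P" and d: "\<And>i. d i \<in> carrier P"
  shows "replace_powers (\<lambda>i. c i \<oplus>\<^bsub>P\<^esub> d i) p = replace_powers c p \<oplus>\<^bsub>P\<^esub> replace_powers d p"
  unfolding replace_powers_def using p c d
  by (subst P.finsum_addf[symmetric]) (simp_all add: Pi_def P.r_distr)

lemma replace_powers_mult_const: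
  assumes p: "p \<in> carrier P" and b: "b \<in> carrier R" and c: "\<And>i. c i \<in> ring_center P"
  shows "replace_powers c (p \<otimes>\<^bsub>P\<^esub> const b) = replace_powers c p \<otimes>\<^bsub>P\<^esub> const b"
  using p c
proof (induction p arbitrary: c rule: poly_induct)
  case zero
  then show ?case using b by (simp add: replace_powers_zero)
next
  case (step a q)
  have *: "(const a \<oplus>\<^bsub>P\<^esub> q \<otimes>\<^bsub>P\<^esub> indet) \<otimes>\<^bsub>P\<^esub> const b
      = const (a \<otimes> b) \<oplus>\<^bsub>P\<^esub> (q \<otimes>\<^bsub>P\<^esub> const b) \<otimes>\<^bsub>P\<^esub> indet"
    using step b P.center_comm[OF indet_center monom_closed[OF b, of 0]]
    by (simp add: P.l_distr P.m_assoc const_mult)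
  have **: "const a \<otimes>\<^bsub>P\<^esub> const b \<otimes>\<^bsub>P\<^esub> c 0 = const a \<otimes>\<^bsub>P\<^esub> c 0 \<otimes>\<^bsub>P\<^esub> const b"
    using step b P.center_comm[OF step.prems[of 0] monom_closed[OF b, of 0]]
    by (simp add: P.m_assoc)
  show ?case
    unfolding * using step b
    by (subst (1 2) replace_powers_step) (simp_all add: const_mult P.l_distr **)
qed

text \<open>Expanding only the right factor reduces the image of a product to a single map: \<open>x^i h\<close> goes
  to the image of \<open>h\<close> under the shifted sequence. If the shifted images have the form \<open>c\<^sub>i z\<close>, this
  says that the map turns multiplication by \<open>h\<close> into multiplication by \<open>z\<close>.\<close>

lemma replace_powers_mult:
  assumes p: "p \<in> carrier P" and h: "h \<in> carrier P" and c: "\<And>i. c i \<in> ring_center P"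
  shows "replace_powers c (p \<otimes>\<^bsub>P\<^esub> h) = replace_powers (\<lambda>i. replace_powers (\<lambda>j. c (i + j)) h) p"
  using h c
proof (induction h arbitrary: c rule: poly_induct)
  case zero
  then show ?case using p
    by (simp add: replace_powers_zero) (simp add: replace_powers_def)
next
  case (step b q)
  let ?r = "\<lambda>i. replace_powers (\<lambda>j. c (Suc i + j)) q"
  have "replace_powers c (p \<otimes>\<^bsub>P\<^esub> (const b \<oplus>\<^bsub>P\<^esub> q \<otimes>\<^bsub>P\<^esub> indet))
      = replace_powers c (p \<otimes>\<^bsub>P\<^esub> const b) \<oplus>\<^bsub>P\<^esub> replace_powers c (p \<otimes>\<^bsub>P\<^esub> q \<otimes>\<^bsub>P\<^esub> indet)"
    using p step by (simp add: P.r_distr P.m_assoc replace_powers_add)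
  also have "replace_powers c (p \<otimes>\<^bsub>P\<^esub> q \<otimes>\<^bsub>P\<^esub> indet) = replace_powers ?r p"
    using p step by (simp add: replace_powers_mult_indet)
  also have "replace_powers c (p \<otimes>\<^bsub>P\<^esub> const b) = replace_powers (\<lambda>i. c i \<otimes>\<^bsub>P\<^esub> const b) p"
    using p step by (simp add: replace_powers_mult_const replace_powers_rmult)
  also have "replace_powers (\<lambda>i. c i \<otimes>\<^bsub>P\<^esub> const b) p \<oplus>\<^bsub>P\<^esub> replace_powers ?r p
      = replace_powers (\<lambda>i. c i \<otimes>\<^bsub>P\<^esub> const b \<oplus>\<^bsub>P\<^esub> ?r i) p"
    using p step by (simp add: replace_powers_add_family)
  also have "\<dots> = replace_powers (\<lambda>i. replace_powers (\<lambda>j. c (i + j)) (const b \<oplus>\<^bsub>P\<^esub> q \<otimes>\<^bsub>P\<^esub> indet)) p"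
    using step P.center_comm[OF step.prems monom_closed[OF step.hyps(1), of 0]]
    by (simp add: replace_powers_step)
  finally show ?case .
qed

text \<open>A left ideal only absorbs factors on the left; centrality of the \<open>c\<^sub>i\<close> allows them to be moved
  there.\<close>

lemma replace_powers_in_left_ideal:
  assumes L: "left_ideal L P" and c: "\<And>i. c i \<in> ring_center P"
    and p: "\<And>n. const (coeff P p n) \<in> L"
  shows "replace_powers c p \<in> L"
proof -
  interpret L: left_ideal L P by (rule L)
  have "const (coeff P p i) \<otimes>\<^bsub>P\<^esub> c i \<in> L" for i
  proof -
    have "const (coeff P p i) \<otimes>\<^bsub>P\<^esub> c i = c i \<otimes>\<^bsub>P\<^esub> const (coeff P p i)"
      by (rule P.center_comm[OF c L.mem_carrier[OF p], symmetric])
    then show ?thesis using L.left_closed[OF p] c by simp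
  qed
  then show ?thesis unfolding replace_powers_def by (intro L.finsum_mem) simp_all
qed

lemma replace_powers_center:
  assumes c: "\<And>i. c i \<in> ring_center P" and g: "g \<in> ring_center P"
  shows "replace_powers c g \<in> ring_center P"
  unfolding replace_powers_def
  by (intro P.center_finsum P.center_mult const_center coeff_center c g) simp

end

section \<open>Substitution of the square of the indeterminate\<close>

context UP_ring
begin

lemma indet_power_center: "monom P \<one> n \<in> ring_center P"
proof (induction n)
  case (Suc n)
  then show ?case
    unfolding monom_one_Suc using P.center_mult[OF _ indet_center] by (simp add: indet_def)
qed (simp add: P.center_one)

text \<open>The substitution \<open>p(x) \<mapsto> p(x\<^sup>2)\<close>.\<close>

definition at_square :: "(nat \<Rightarrow> 'a) \<Rightarrow> nat \<Rightarrow> 'a" where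
  "at_square = replace_powers (\<lambda>i. monom P \<one> (2 * i))"

lemma at_square_closed [simp]: "p \<in> carrier P \<Longrightarrow> at_square p \<in> carrier P"
  by (simp add: at_square_def)

lemma at_square_center: "g \<in> ring_center P \<Longrightarrow> at_square g \<in> ring_center P"
  unfolding at_square_def by (intro replace_powers_center indet_power_center)

lemma at_square_zero: "at_square \<zero>\<^bsub>P\<^esub> = \<zero>\<^bsub>P\<^esub>"
  by (simp add: at_square_def replace_powers_zero)

lemma at_square_add: "\<lbrakk>p \<in> carrier P; q \<in> carrier P\<rbrakk> \<Longrightarrow> at_square (p \<oplus>\<^bsub>P\<^esub> q) = at_square p \<oplus>\<^bsub>P\<^esub> at_square q"
  by (simp add: at_square_def replace_powers_add)

lemma at_square_minus: "\<lbrakk>p \<in> carrier P; q \<in> carrier P\<rbrakk> \<Longrightarrow> at_square (p \<ominus>\<^bsub>P\<^esub> q) = at_square p \<ominus>\<^bsub>P\<^esub> at_square q"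
  by (simp add: at_square_def replace_powers_minus)

lemma at_square_const: "a \<in> carrier R \<Longrightarrow> at_square (const a) = const a"
  by (simp add: at_square_def replace_powers_const)

lemma at_square_mult_indet:
  assumes "p \<in> carrier P"
  shows "at_square (p \<otimes>\<^bsub>P\<^esub> indet) = at_square p \<otimes>\<^bsub>P\<^esub> (indet \<otimes>\<^bsub>P\<^esub> indet)"
proof -
  have "monom P \<one> (2 * Suc i) = monom P \<one> (2 * i) \<otimes>\<^bsub>P\<^esub> (indet \<otimes>\<^bsub>P\<^esub> indet)" for i
    using monom_one_Suc[of "Suc (2 * i)"] monom_one_Suc[of "2 * i"]
    by (simp add: indet_def P.m_assoc)
  then show ?thesis
    using assms by (simp add: at_square_def replace_powers_mult_indet replace_powers_rmult)
qed

lemma at_square_indet: "at_square indet = indet \<otimes>\<^bsub>P\<^esub> indet"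
  using at_square_mult_indet[OF UP_one_closed] at_square_const[OF R.one_closed] by simp

lemma at_square_mult:
  assumes p: "p \<in> carrier P" and q: "q \<in> carrier P"
  shows "at_square (p \<otimes>\<^bsub>P\<^esub> q) = at_square p \<otimes>\<^bsub>P\<^esub> at_square q"
  using q
proof (induction q rule: poly_induct)
  case zero
  then show ?case using p by (simp add: at_square_zero)
next
  case (step b q)
  have "at_square (p \<otimes>\<^bsub>P\<^esub> const b) = at_square p \<otimes>\<^bsub>P\<^esub> const b"
    unfolding at_square_def using p step by (intro replace_powers_mult_const indet_power_center)
  moreover have "p \<otimes>\<^bsub>P\<^esub> (const b \<oplus>\<^bsub>P\<^esub> q \<otimes>\<^bsub>P\<^esub> indet) = p \<otimes>\<^bsub>P\<^esub> const b \<oplus>\<^bsub>P\<^esub> p \<otimes>\<^bsub>P\<^esub> q \<otimes>\<^bsub>P\<^esub> indet"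
    using p step by (simp add: P.r_distr P.m_assoc)
  ultimately show ?case
    using p step at_square_mult_indet[of "p \<otimes>\<^bsub>P\<^esub> q"]
    by (simp add: at_square_add at_square_mult_indet at_square_const P.r_distr P.m_assoc)
qed

lemma coeff_at_square:
  assumes "p \<in> carrier P"
  shows "coeff P (at_square p) n = (if even n then coeff P p (n div 2) else \<zero>)"
  using assms
proof (induction p arbitrary: n rule: poly_induct)
  case zero
  then show ?case by (simp add: at_square_zero)
next
  case (step a q)
  have "at_square (const a \<oplus>\<^bsub>P\<^esub> q \<otimes>\<^bsub>P\<^esub> indet) = const a \<oplus>\<^bsub>P\<^esub> at_square q \<otimes>\<^bsub>P\<^esub> indet \<otimes>\<^bsub>P\<^esub> indet"
    using step by (simp add: at_square_add at_square_mult_indet at_square_const P.m_assoc)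
  moreover obtain m where "n = 0 \<or> n = 1 \<or> n = Suc (Suc m)"
    by (metis One_nat_def not0_implies_Suc)
  ultimately show ?case
    using step by (auto simp: coeff_mult_indet simp del: coeff_mult)
qed

text \<open>The induction moves from \<open>q\<close> to \<open>a + q x\<close>, which exchanges the even and the odd part.\<close>

lemma even_odd_decomposition:
  assumes "p \<in> carrier P"
  obtains p0 p1 where "p0 \<in> carrier P" "p1 \<in> carrier P"
    "p = at_square p0 \<oplus>\<^bsub>P\<^esub> indet \<otimes>\<^bsub>P\<^esub> at_square p1"
proof -
  have "\<exists>p0\<in>carrier P. \<exists>p1\<in>carrier P. p = at_square p0 \<oplus>\<^bsub>P\<^esub> indet \<otimes>\<^bsub>P\<^esub> at_square p1"
    using assms
  proof (induction p rule: poly_induct)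
    case zero
    show ?case by (intro bexI[of _ "\<zero>\<^bsub>P\<^esub>"]) (simp_all add: at_square_zero)
  next
    case (step a q)
    then obtain q0 q1 where q: "q0 \<in> carrier P" "q1 \<in> carrier P"
      and e: "q = at_square q0 \<oplus>\<^bsub>P\<^esub> indet \<otimes>\<^bsub>P\<^esub> at_square q1" by blast
    have "q \<otimes>\<^bsub>P\<^esub> indet = indet \<otimes>\<^bsub>P\<^esub> q" using P.center_comm[OF indet_center step(2)] by simp
    also have "\<dots> = indet \<otimes>\<^bsub>P\<^esub> at_square q0 \<oplus>\<^bsub>P\<^esub> (indet \<otimes>\<^bsub>P\<^esub> indet) \<otimes>\<^bsub>P\<^esub> at_square q1"
      unfolding e using q by (simp add: P.r_distr P.m_assoc)
    also have "(indet \<otimes>\<^bsub>P\<^esub> indet) \<otimes>\<^bsub>P\<^esub> at_square q1 = at_square q1 \<otimes>\<^bsub>P\<^esub> (indet \<otimes>\<^bsub>P\<^esub> indet)"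
      using q by (intro P.center_comm P.center_mult indet_center) simp
    finally have "const a \<oplus>\<^bsub>P\<^esub> q \<otimes>\<^bsub>P\<^esub> indet
        = at_square (const a \<oplus>\<^bsub>P\<^esub> q1 \<otimes>\<^bsub>P\<^esub> indet) \<oplus>\<^bsub>P\<^esub> indet \<otimes>\<^bsub>P\<^esub> at_square q0"
      using q step(1)
      by (simp add: at_square_add at_square_const at_square_mult_indet P.a_ac)
    then show ?case using q step(1) by (metis UP_a_closed UP_mult_closed indet_closed monom_closed)
  qed
  then show thesis using that by blast
qed

section \<open>Central monic polynomials\<close>

text \<open>The leading coefficient is tied to an explicit exponent \<open>d\<close> and not to the degree function, so
  that the notion behaves well over the zero ring, where every polynomial has degree \<open>0\<close>.\<close>

definition central_monic :: "nat \<Rightarrow> (nat \<Rightarrow> 'a) \<Rightarrow> bool" where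
  "central_monic d g \<longleftrightarrow> g \<in> ring_center P \<and> coeff P g d = \<one> \<and> (\<forall>n>d. coeff P g n = \<zero>)"

lemma central_monic_center: "central_monic d g \<Longrightarrow> g \<in> ring_center P"
  by (simp add: central_monic_def)

lemma central_monic_closed: "central_monic d g \<Longrightarrow> g \<in> carrier P"
  by (simp add: central_monic_def)

lemma central_monic_monom: "central_monic d (monom P \<one> d)"
  by (simp add: central_monic_def indet_power_center)

lemma central_monic_deg: "central_monic d g \<Longrightarrow> deg R g \<le> d"
  by (intro deg_aboveI) (simp_all add: central_monic_def)

lemma central_monic_zero_eq_one:
  assumes "central_monic 0 g"
  shows "g = \<one>\<^bsub>P\<^esub>"
proof (rule up_eqI)
  show "coeff P g n = coeff P \<one>\<^bsub>P\<^esub> n" for n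
    using assms by (cases n) (simp_all add: central_monic_def)
qed (use assms in \<open>simp_all add: central_monic_closed\<close>)

lemma central_monic_mult:
  assumes g: "central_monic d g" and h: "central_monic e h"
  shows "central_monic (d + e) (g \<otimes>\<^bsub>P\<^esub> h)"
proof -
  have gc: "g \<in> carrier P" and hc: "h \<in> carrier P"
    using g h by (simp_all add: central_monic_closed)
  have "coeff P (g \<otimes>\<^bsub>P\<^esub> h) (d + e) = (\<Oplus>i\<in>{..d + e}. if d = i then \<one> else \<zero>)"
  proof -
    have "coeff P g i \<otimes> coeff P h (d + e - i) = (if d = i then \<one> else \<zero>)" for i
    proof (cases i d rule: linorder_cases)
      case less
      then have "d + e - i > e" by simp
      then show ?thesis using less gc h by (simp add: central_monic_def)
    next
      case equal
      then show ?thesis using g h by (simp add: central_monic_def)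
    next
      case greater
      then show ?thesis using g hc by (simp add: central_monic_def)
    qed
    then show ?thesis using gc hc by simp
  qed
  also have "\<dots> = \<one>" by (subst R.finsum_singleton) auto
  finally have "coeff P (g \<otimes>\<^bsub>P\<^esub> h) (d + e) = \<one>" .
  moreover have "coeff P (g \<otimes>\<^bsub>P\<^esub> h) n = \<zero>" if "n > d + e" for n
    using that deg_mult_ring[OF gc hc] central_monic_deg[OF g] central_monic_deg[OF h] gc hc
    by (intro deg_aboveD) simp_all
  ultimately show ?thesis
    using P.center_mult g h by (simp add: central_monic_def del: coeff_mult)
qed

lemma central_monic_minus:
  assumes g: "central_monic d g" and h: "central_monic e h" and "e < d"
  shows "central_monic d (g \<ominus>\<^bsub>P\<^esub> h)"
  using assms by (simp add: central_monic_def P.center_minus) (simp add: P.minus_eq R.minus_eq)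

lemma central_monic_at_square:
  assumes g: "central_monic d g"
  shows "central_monic (2 * d) (at_square g)"
  using g central_monic_closed[OF g]
  by (auto simp: central_monic_def at_square_center coeff_at_square)

end

text \<open>Let \<open>g\<close> be central and monic of degree \<open>d\<close>. Then \<open>R[x]\<close> is free over \<open>R[g]\<close> with basis
  \<open>1, x, \<dots>, x^(d - 1)\<close>, and the \<open>n\<close>-th term of the following sequence is the coordinate of \<open>x^n\<close>
  at the basis element \<open>1\<close>, with the indeterminate written for \<open>g\<close>. Defining the coordinates by the
  recursion that comes from \<open>x^d = g - \<Sum>j<d. g\<^sub>j x^j\<close> avoids division with remainder. The case
  distinction inside the sum records \<open>j < d\<close> for the termination proof, and the values for
  \<open>d = 0\<close> only stop the recursion.\<close>

fun (in UP_ring) powers_over_base :: "(nat \<Rightarrow> 'a) \<Rightarrow> nat \<Rightarrow> nat \<Rightarrow> nat \<Rightarrow> 'a" where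
  "powers_over_base g d n =
    (if n < d \<or> d = 0 then (if n = 0 then \<one>\<^bsub>P\<^esub> else \<zero>\<^bsub>P\<^esub>)
     else indet \<otimes>\<^bsub>P\<^esub> powers_over_base g d (n - d)
       \<ominus>\<^bsub>P\<^esub> (\<Oplus>\<^bsub>P\<^esub>j\<in>{..<d}. if j < d then const (coeff P g j) \<otimes>\<^bsub>P\<^esub> powers_over_base g d (n - d + j) else \<zero>\<^bsub>P\<^esub>))"

context UP_ring
begin

declare powers_over_base.simps [simp del]

lemma powers_over_base_center:
  assumes g: "g \<in> ring_center P"
  shows "powers_over_base g d n \<in> ring_center P"
proof (induction n rule: less_induct)
  case (less n)
  show ?case
  proof (cases "n < d \<or> d = 0")
    case True
    then show ?thesis
      by (subst powers_over_base.simps) (simp add: P.center_one P.center_zero)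
  next
    case False
    then have "powers_over_base g d (n - d) \<in> ring_center P"
      "\<And>j. j < d \<Longrightarrow> powers_over_base g d (n - d + j) \<in> ring_center P"
      by (auto intro!: less.IH)
    then show ?thesis
      using False P.center_zero
      by (subst powers_over_base.simps)
        (auto intro!: P.center_minus P.center_mult P.center_finsum indet_center const_center coeff_center g)
  qed
qed

text \<open>The coordinate at \<open>1\<close> of \<open>x^i g\<close> is that of \<open>x^i\<close> times \<open>g\<close>: this is the recursion itself, with
  the leading term of \<open>g\<close> brought to the other side.\<close>

lemma powers_over_base_eq:
  assumes g: "central_monic d g" and d: "d > 0"
  shows "replace_powers (\<lambda>j. powers_over_base g d (i + j)) g = indet \<otimes>\<^bsub>P\<^esub> powers_over_base g d i"
proof -
  let ?c = "powers_over_base g d"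
  note c = powers_over_base_center[OF central_monic_center[OF g], of d]
  have gc: "g \<in> carrier P" using g by (rule central_monic_closed)
  obtain e where e: "d = Suc e" using d by (cases d) auto
  let ?s = "\<Oplus>\<^bsub>P\<^esub>j\<in>{..<d}. const (coeff P g j) \<otimes>\<^bsub>P\<^esub> ?c (i + j)"
  have s: "?s \<in> carrier P" using gc c by (simp add: Pi_def)
  have "(\<Oplus>\<^bsub>P\<^esub>j\<in>{..<d}. if j < d then const (coeff P g j) \<otimes>\<^bsub>P\<^esub> ?c (d + i - d + j) else \<zero>\<^bsub>P\<^esub>) = ?s"
    using gc c by (intro P.finsum_cong') (auto simp: Pi_def)
  then have rec: "?c (d + i) = indet \<otimes>\<^bsub>P\<^esub> ?c i \<ominus>\<^bsub>P\<^esub> ?s"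
    using d by (subst powers_over_base.simps) simp
  have "replace_powers (\<lambda>j. ?c (i + j)) g = (\<Oplus>\<^bsub>P\<^esub>j\<in>{..d}. const (coeff P g j) \<otimes>\<^bsub>P\<^esub> ?c (i + j))"
    using c gc central_monic_deg[OF g] by (intro replace_powers_atMost) simp_all
  also have "\<dots> = const (coeff P g d) \<otimes>\<^bsub>P\<^esub> ?c (i + d) \<oplus>\<^bsub>P\<^esub> ?s"
    using gc c unfolding e by (subst P.finsum_Suc) (simp_all add: Pi_def lessThan_Suc_atMost)
  also have "\<dots> = ?c (d + i) \<oplus>\<^bsub>P\<^esub> ?s"
    using g c by (simp add: central_monic_def add.commute)
  also have "\<dots> = indet \<otimes>\<^bsub>P\<^esub> ?c i"
    unfolding rec using s c[of i] by (simp add: P.minus_eq P.a_assoc P.l_neg)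
  finally show ?thesis .
qed

end

section \<open>The radical under substitution\<close>

lemma (in UP_ring) mem_polys_over:
  "p \<in> polys_over R N \<longleftrightarrow> p \<in> carrier P \<and> (\<forall>n. coeff P p n \<in> N)"
  unfolding polys_over_def P_def by simp

locale UP_left_ideal = UP_ring + I: left_ideal I R for I
begin

definition J :: "(nat \<Rightarrow> 'a) set" where
  "J = j_radical P (polys_over R I)"

lemma I_zero: "\<zero> \<in> I"
  by (rule additive_subgroup.zero_closed[OF I.is_additive_subgroup])

lemma left_ideal_polys_over: "left_ideal (polys_over R I) P"
proof (rule P.left_idealI)
  show "polys_over R I \<subseteq> carrier P" by (auto simp: mem_polys_over)
  show "\<zero>\<^bsub>P\<^esub> \<in> polys_over R I" by (simp add: mem_polys_over I_zero)
  show "p \<oplus>\<^bsub>P\<^esub> q \<in> polys_over R I" if "p \<in> polys_over R I" "q \<in> polys_over R I" for p q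
    using that additive_subgroup.a_closed[OF I.is_additive_subgroup] by (simp add: mem_polys_over)
  show "q \<otimes>\<^bsub>P\<^esub> p \<in> polys_over R I" if "p \<in> polys_over R I" "q \<in> carrier P" for p q
    using that by (auto simp: mem_polys_over intro!: I.finsum_mem I.left_closed)
qed

lemma replace_powers_polys_over:
  assumes "\<And>i. c i \<in> ring_center P" "p \<in> polys_over R I"
  shows "replace_powers c p \<in> polys_over R I"
  using left_ideal_polys_over assms(1)
proof (rule replace_powers_in_left_ideal)
  show "const (coeff P p n) \<in> polys_over R I" for n
    using assms(2) by (simp add: mem_polys_over I_zero)
qed

lemmas J_iff = left_ideal.mem_j_radical_iff[OF left_ideal_polys_over, folded J_def]

lemma left_ideal_J: "left_ideal J P"
  unfolding J_def by (rule left_ideal.left_ideal_j_radical[OF left_ideal_polys_over])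

sublocale L: left_ideal "polys_over R I" P by (rule left_ideal_polys_over)
sublocale J: left_ideal J P by (rule left_ideal_J)

text \<open>The ring \<open>R[x]\<close> is free over \<open>R[x\<^sup>2]\<close> with basis \<open>1, x\<close>. Write \<open>F = f(x\<^sup>2)\<close> and split the test
  element as \<open>t = t\<^sub>0(x\<^sup>2) + x t\<^sub>1(x\<^sup>2)\<close>. A left inverse of \<open>1 - t\<^sub>0(x\<^sup>2) F\<close> modulo \<open>I[x]\<close>, obtained by
  substitution from one for \<open>f\<close>, removes the even part and leaves \<open>1 - H\<close> with \<open>H = x s(x\<^sup>2) F\<close>.
  Multiplication by \<open>1 + H\<close> gives \<open>1 - H\<^sup>2\<close>, and \<open>H\<^sup>2\<close> is again of the form \<open>t\<^sub>2(x\<^sup>2) F\<close> because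
  \<open>x\<close> occurs in it only through \<open>x\<^sup>2\<close>.\<close>

lemma at_square_J:
  assumes f: "f \<in> J"
  shows "at_square f \<in> J"
proof -
  let ?L = "polys_over R I"
  have fc: "f \<in> carrier P" using f by simp
  have inv: "\<exists>u\<in>carrier P. \<exists>y\<in>?L. u \<otimes>\<^bsub>P\<^esub> (\<one>\<^bsub>P\<^esub> \<ominus>\<^bsub>P\<^esub> t \<otimes>\<^bsub>P\<^esub> f) = \<one>\<^bsub>P\<^esub> \<oplus>\<^bsub>P\<^esub> y" if "t \<in> carrier P" for t
    using f that unfolding J_iff by simp
  define F where "F = at_square f"
  have F: "F \<in> carrier P" using fc by (simp add: F_def)
  have inv2: "\<exists>u\<in>carrier P. \<exists>y\<in>?L. at_square u \<otimes>\<^bsub>P\<^esub> (\<one>\<^bsub>P\<^esub> \<ominus>\<^bsub>P\<^esub> at_square t \<otimes>\<^bsub>P\<^esub> F) = \<one>\<^bsub>P\<^esub> \<oplus>\<^bsub>P\<^esub> y"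
    if t: "t \<in> carrier P" for t
  proof -
    obtain u y where u: "u \<in> carrier P" and y: "y \<in> ?L"
      and e: "u \<otimes>\<^bsub>P\<^esub> (\<one>\<^bsub>P\<^esub> \<ominus>\<^bsub>P\<^esub> t \<otimes>\<^bsub>P\<^esub> f) = \<one>\<^bsub>P\<^esub> \<oplus>\<^bsub>P\<^esub> y"
      using inv[OF t] by blast
    have "at_square u \<otimes>\<^bsub>P\<^esub> (\<one>\<^bsub>P\<^esub> \<ominus>\<^bsub>P\<^esub> at_square t \<otimes>\<^bsub>P\<^esub> F) = \<one>\<^bsub>P\<^esub> \<oplus>\<^bsub>P\<^esub> at_square y"
      using arg_cong[OF e, of at_square] u t y fc at_square_const[OF R.one_closed]
      by (simp add: F_def at_square_mult at_square_minus at_square_add)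
    moreover have "at_square y \<in> ?L"
      unfolding at_square_def by (intro replace_powers_polys_over indet_power_center y)
    ultimately show ?thesis using u by blast
  qed
  have "\<exists>w\<in>carrier P. \<exists>y\<in>?L. w \<otimes>\<^bsub>P\<^esub> (\<one>\<^bsub>P\<^esub> \<ominus>\<^bsub>P\<^esub> t \<otimes>\<^bsub>P\<^esub> F) = \<one>\<^bsub>P\<^esub> \<oplus>\<^bsub>P\<^esub> y"
    if t: "t \<in> carrier P" for t
  proof -
    obtain t0 t1 where t01: "t0 \<in> carrier P" "t1 \<in> carrier P"
      and te: "t = at_square t0 \<oplus>\<^bsub>P\<^esub> indet \<otimes>\<^bsub>P\<^esub> at_square t1"
      using even_odd_decomposition[OF t] by blast
    obtain u y where u: "u \<in> carrier P" and y: "y \<in> ?L"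
      and uy: "at_square u \<otimes>\<^bsub>P\<^esub> (\<one>\<^bsub>P\<^esub> \<ominus>\<^bsub>P\<^esub> at_square t0 \<otimes>\<^bsub>P\<^esub> F) = \<one>\<^bsub>P\<^esub> \<oplus>\<^bsub>P\<^esub> y"
      using inv2[OF t01(1)] by blast
    define s where "s = u \<otimes>\<^bsub>P\<^esub> t1"
    have s: "s \<in> carrier P" using u t01 by (simp add: s_def)
    define G where "G = at_square s \<otimes>\<^bsub>P\<^esub> F"
    have G: "G \<in> carrier P" using s F by (simp add: G_def)
    define H where "H = indet \<otimes>\<^bsub>P\<^esub> G"
    have H: "H \<in> carrier P" using G by (simp add: H_def)
    have a: "at_square u \<otimes>\<^bsub>P\<^esub> (\<one>\<^bsub>P\<^esub> \<ominus>\<^bsub>P\<^esub> t \<otimes>\<^bsub>P\<^esub> F) = (\<one>\<^bsub>P\<^esub> \<ominus>\<^bsub>P\<^esub> H) \<oplus>\<^bsub>P\<^esub> y"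
    proof -
      have "at_square u \<otimes>\<^bsub>P\<^esub> (indet \<otimes>\<^bsub>P\<^esub> at_square t1 \<otimes>\<^bsub>P\<^esub> F) = (at_square u \<otimes>\<^bsub>P\<^esub> indet) \<otimes>\<^bsub>P\<^esub> at_square t1 \<otimes>\<^bsub>P\<^esub> F"
        using u t01 F by (simp add: P.m_assoc)
      also have "at_square u \<otimes>\<^bsub>P\<^esub> indet = indet \<otimes>\<^bsub>P\<^esub> at_square u"
        using u by (intro P.center_comm[symmetric] indet_center) simp
      finally have 1: "at_square u \<otimes>\<^bsub>P\<^esub> (indet \<otimes>\<^bsub>P\<^esub> at_square t1 \<otimes>\<^bsub>P\<^esub> F) = H"
        using u t01 F by (simp add: H_def G_def s_def at_square_mult P.m_assoc)
      have "\<one>\<^bsub>P\<^esub> \<ominus>\<^bsub>P\<^esub> t \<otimes>\<^bsub>P\<^esub> F = (\<one>\<^bsub>P\<^esub> \<ominus>\<^bsub>P\<^esub> at_square t0 \<otimes>\<^bsub>P\<^esub> F) \<ominus>\<^bsub>P\<^esub> indet \<otimes>\<^bsub>P\<^esub> at_square t1 \<otimes>\<^bsub>P\<^esub> F"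
        unfolding te using t01 F
        by (simp add: P.l_distr P.minus_eq P.minus_add P.a_assoc)
      then have "at_square u \<otimes>\<^bsub>P\<^esub> (\<one>\<^bsub>P\<^esub> \<ominus>\<^bsub>P\<^esub> t \<otimes>\<^bsub>P\<^esub> F)
          = at_square u \<otimes>\<^bsub>P\<^esub> (\<one>\<^bsub>P\<^esub> \<ominus>\<^bsub>P\<^esub> at_square t0 \<otimes>\<^bsub>P\<^esub> F) \<ominus>\<^bsub>P\<^esub> at_square u \<otimes>\<^bsub>P\<^esub> (indet \<otimes>\<^bsub>P\<^esub> at_square t1 \<otimes>\<^bsub>P\<^esub> F)"
        using u t01 F by (simp add: P.r_distr P.minus_eq P.r_minus)
      then show ?thesis
        unfolding uy 1 using y H by (simp add: P.minus_eq P.a_ac)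
    qed
    \<comment> \<open>The element \<open>x s f s\<close> becomes \<open>x\<^sup>2 s(x\<^sup>2) F s(x\<^sup>2)\<close> under the substitution, and a factor \<open>F\<close> on
    its right completes it to \<open>H\<^sup>2\<close>.\<close>
    have tt: "indet \<otimes>\<^bsub>P\<^esub> (s \<otimes>\<^bsub>P\<^esub> f \<otimes>\<^bsub>P\<^esub> s) \<in> carrier P" using s fc by simp
    obtain v z where v: "v \<in> carrier P" and z: "z \<in> ?L"
      and vz: "at_square v \<otimes>\<^bsub>P\<^esub> (\<one>\<^bsub>P\<^esub> \<ominus>\<^bsub>P\<^esub> at_square (indet \<otimes>\<^bsub>P\<^esub> (s \<otimes>\<^bsub>P\<^esub> f \<otimes>\<^bsub>P\<^esub> s)) \<otimes>\<^bsub>P\<^esub> F) = \<one>\<^bsub>P\<^esub> \<oplus>\<^bsub>P\<^esub> z"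
      using inv2[OF tt] by blast
    have "H \<otimes>\<^bsub>P\<^esub> H = indet \<otimes>\<^bsub>P\<^esub> (G \<otimes>\<^bsub>P\<^esub> indet) \<otimes>\<^bsub>P\<^esub> G"
      using G by (simp add: H_def P.m_assoc)
    also have "G \<otimes>\<^bsub>P\<^esub> indet = indet \<otimes>\<^bsub>P\<^esub> G"
      by (rule P.center_comm[OF indet_center G, symmetric])
    finally have HH: "at_square (indet \<otimes>\<^bsub>P\<^esub> (s \<otimes>\<^bsub>P\<^esub> f \<otimes>\<^bsub>P\<^esub> s)) \<otimes>\<^bsub>P\<^esub> F = H \<otimes>\<^bsub>P\<^esub> H"
      using s fc F by (simp add: G_def at_square_mult at_square_indet P.m_assoc flip: F_def)
    have sq: "(\<one>\<^bsub>P\<^esub> \<oplus>\<^bsub>P\<^esub> H) \<otimes>\<^bsub>P\<^esub> (\<one>\<^bsub>P\<^esub> \<ominus>\<^bsub>P\<^esub> H) = \<one>\<^bsub>P\<^esub> \<ominus>\<^bsub>P\<^esub> H \<otimes>\<^bsub>P\<^esub> H"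
      using H by (simp add: P.l_distr P.r_distr P.minus_eq P.r_minus P.minus_add P.a_assoc P.r_neg2)
    let ?r = "at_square v \<otimes>\<^bsub>P\<^esub> (\<one>\<^bsub>P\<^esub> \<oplus>\<^bsub>P\<^esub> H)"
    have r: "?r \<in> carrier P" using v H by simp
    have "?r \<otimes>\<^bsub>P\<^esub> at_square u \<otimes>\<^bsub>P\<^esub> (\<one>\<^bsub>P\<^esub> \<ominus>\<^bsub>P\<^esub> t \<otimes>\<^bsub>P\<^esub> F) = ?r \<otimes>\<^bsub>P\<^esub> (\<one>\<^bsub>P\<^esub> \<ominus>\<^bsub>P\<^esub> H) \<oplus>\<^bsub>P\<^esub> ?r \<otimes>\<^bsub>P\<^esub> y"
      using r u t F H y a by (simp only: P.m_assoc P.r_distr P.minus_closed at_square_closed UP_mult_closed UP_one_closed L.mem_carrier)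
    also have "?r \<otimes>\<^bsub>P\<^esub> (\<one>\<^bsub>P\<^esub> \<ominus>\<^bsub>P\<^esub> H) = \<one>\<^bsub>P\<^esub> \<oplus>\<^bsub>P\<^esub> z"
      using vz v H unfolding HH sq[symmetric] by (simp add: P.m_assoc)
    also have "(\<one>\<^bsub>P\<^esub> \<oplus>\<^bsub>P\<^esub> z) \<oplus>\<^bsub>P\<^esub> ?r \<otimes>\<^bsub>P\<^esub> y = \<one>\<^bsub>P\<^esub> \<oplus>\<^bsub>P\<^esub> (z \<oplus>\<^bsub>P\<^esub> ?r \<otimes>\<^bsub>P\<^esub> y)"
      using z y r by (simp add: P.a_assoc)
    finally have "?r \<otimes>\<^bsub>P\<^esub> at_square u \<otimes>\<^bsub>P\<^esub> (\<one>\<^bsub>P\<^esub> \<ominus>\<^bsub>P\<^esub> t \<otimes>\<^bsub>P\<^esub> F) = \<one>\<^bsub>P\<^esub> \<oplus>\<^bsub>P\<^esub> (z \<oplus>\<^bsub>P\<^esub> ?r \<otimes>\<^bsub>P\<^esub> y)" .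
    moreover have "z \<oplus>\<^bsub>P\<^esub> ?r \<otimes>\<^bsub>P\<^esub> y \<in> ?L"
      by (intro additive_subgroup.a_closed[OF L.is_additive_subgroup] z L.left_closed y r)
    ultimately show ?thesis using r u by (meson UP_mult_closed at_square_closed)
  qed
  then show ?thesis unfolding J_iff F_def[symmetric] using F by blast
qed

text \<open>Substitution of a central monic \<open>g\<close> of positive degree reflects membership in the radical:
  \<open>h(g) \<in> J\<close> implies \<open>h \<in> J\<close>, here for \<open>h = a(x - z)\<close>. The coordinate map \<open>\<Lambda>\<close> at the basis element
  \<open>1\<close> of \<open>R[x]\<close> over \<open>R[g]\<close> is linear over \<open>R[g]\<close>, fixes \<open>1\<close> and preserves \<open>I[x]\<close>, so it carries a
  left inverse of \<open>1 - t(g) h(g)\<close> modulo \<open>I[x]\<close> to one of \<open>1 - t h\<close>.\<close>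

lemma const_mult_indet_minus_J:
  assumes g: "central_monic d g" and d: "d > 0" and z: "z \<in> ring_center R"
    and a: "a \<in> carrier R"
    and ag: "const a \<otimes>\<^bsub>P\<^esub> (g \<ominus>\<^bsub>P\<^esub> const z) \<in> J"
  shows "const a \<otimes>\<^bsub>P\<^esub> (indet \<ominus>\<^bsub>P\<^esub> const z) \<in> J"
proof -
  let ?L = "polys_over R I"
  define c where "c = powers_over_base g d"
  define \<Lambda> where "\<Lambda> = replace_powers c"
  have gc: "g \<in> carrier P" using g by (rule central_monic_closed)
  have zc: "const z \<in> ring_center P" using z by (rule const_center)
  have c: "c i \<in> ring_center P" for i
    unfolding c_def by (rule powers_over_base_center[OF central_monic_center[OF g]])
  have closed [simp]: "\<Lambda> p \<in> carrier P" if "p \<in> carrier P" for p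
    using c that by (simp add: \<Lambda>_def)
  have add: "\<Lambda> (p \<oplus>\<^bsub>P\<^esub> q) = \<Lambda> p \<oplus>\<^bsub>P\<^esub> \<Lambda> q" if "p \<in> carrier P" "q \<in> carrier P" for p q
    using c that by (simp add: \<Lambda>_def replace_powers_add)
  have minus: "\<Lambda> (p \<ominus>\<^bsub>P\<^esub> q) = \<Lambda> p \<ominus>\<^bsub>P\<^esub> \<Lambda> q" if "p \<in> carrier P" "q \<in> carrier P" for p q
    using c that by (simp add: \<Lambda>_def replace_powers_minus)
  have mult_const: "\<Lambda> (p \<otimes>\<^bsub>P\<^esub> const b) = \<Lambda> p \<otimes>\<^bsub>P\<^esub> const b" if "p \<in> carrier P" "b \<in> carrier R" for p b
    using c that by (simp add: \<Lambda>_def replace_powers_mult_const)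
  have "c 0 = \<one>\<^bsub>P\<^esub>" unfolding c_def using d by (subst powers_over_base.simps) simp
  then have one: "\<Lambda> \<one>\<^bsub>P\<^esub> = \<one>\<^bsub>P\<^esub>"
    using replace_powers_const[of c \<one>] c by (simp add: \<Lambda>_def)
  have mult_g: "\<Lambda> (p \<otimes>\<^bsub>P\<^esub> g) = \<Lambda> p \<otimes>\<^bsub>P\<^esub> indet" if p: "p \<in> carrier P" for p
  proof -
    have "\<Lambda> (p \<otimes>\<^bsub>P\<^esub> g) = replace_powers (\<lambda>i. c i \<otimes>\<^bsub>P\<^esub> indet) p"
      unfolding \<Lambda>_def using p gc c powers_over_base_eq[OF g d, folded c_def] P.center_comm[OF indet_center]
      by (simp add: replace_powers_mult)
    then show ?thesis using p c by (simp add: \<Lambda>_def replace_powers_rmult)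
  qed
  \<comment> \<open>The witness \<open>t'\<close> is \<open>t(g)\<close>; only its interaction with \<open>\<Lambda>\<close> matters.\<close>
  have lift: "\<exists>t'\<in>carrier P. \<forall>p\<in>carrier P. \<Lambda> (p \<otimes>\<^bsub>P\<^esub> t') = \<Lambda> p \<otimes>\<^bsub>P\<^esub> t" if "t \<in> carrier P" for t
    using that
  proof (induction t rule: poly_induct)
    case zero
    have "\<Lambda> \<zero>\<^bsub>P\<^esub> = \<zero>\<^bsub>P\<^esub>" using c by (simp add: \<Lambda>_def replace_powers_zero)
    then show ?case by (intro bexI[of _ "\<zero>\<^bsub>P\<^esub>"]) simp_all
  next
    case (step b q)
    then obtain q' where q': "q' \<in> carrier P" "\<And>p. p \<in> carrier P \<Longrightarrow> \<Lambda> (p \<otimes>\<^bsub>P\<^esub> q') = \<Lambda> p \<otimes>\<^bsub>P\<^esub> q"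
      by blast
    have "\<Lambda> (p \<otimes>\<^bsub>P\<^esub> (const b \<oplus>\<^bsub>P\<^esub> q' \<otimes>\<^bsub>P\<^esub> g)) = \<Lambda> p \<otimes>\<^bsub>P\<^esub> (const b \<oplus>\<^bsub>P\<^esub> q \<otimes>\<^bsub>P\<^esub> indet)"
      if p: "p \<in> carrier P" for p
    proof -
      have "\<Lambda> (p \<otimes>\<^bsub>P\<^esub> (const b \<oplus>\<^bsub>P\<^esub> q' \<otimes>\<^bsub>P\<^esub> g)) = \<Lambda> (p \<otimes>\<^bsub>P\<^esub> const b) \<oplus>\<^bsub>P\<^esub> \<Lambda> ((p \<otimes>\<^bsub>P\<^esub> q') \<otimes>\<^bsub>P\<^esub> g)"
        using p q'(1) step gc by (simp add: P.r_distr P.m_assoc add)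
      also have "\<dots> = \<Lambda> p \<otimes>\<^bsub>P\<^esub> const b \<oplus>\<^bsub>P\<^esub> (\<Lambda> p \<otimes>\<^bsub>P\<^esub> q) \<otimes>\<^bsub>P\<^esub> indet"
        using p q' step by (simp only: mult_const mult_g UP_mult_closed)
      finally show ?thesis using p step by (simp add: P.r_distr P.m_assoc)
    qed
    then show ?case using q'(1) step gc by (intro bexI[of _ "const b \<oplus>\<^bsub>P\<^esub> q' \<otimes>\<^bsub>P\<^esub> g"]) simp_all
  qed
  have "\<exists>w\<in>carrier P. \<exists>y\<in>?L. w \<otimes>\<^bsub>P\<^esub> (\<one>\<^bsub>P\<^esub> \<ominus>\<^bsub>P\<^esub> t \<otimes>\<^bsub>P\<^esub> (const a \<otimes>\<^bsub>P\<^esub> (indet \<ominus>\<^bsub>P\<^esub> const z))) = \<one>\<^bsub>P\<^esub> \<oplus>\<^bsub>P\<^esub> y"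
    if t: "t \<in> carrier P" for t
  proof -
    obtain t' where t': "t' \<in> carrier P" and tt': "\<And>p. p \<in> carrier P \<Longrightarrow> \<Lambda> (p \<otimes>\<^bsub>P\<^esub> t') = \<Lambda> p \<otimes>\<^bsub>P\<^esub> t"
      using lift[OF t] by blast
    obtain u y where u: "u \<in> carrier P" and y: "y \<in> ?L"
      and e: "u \<otimes>\<^bsub>P\<^esub> (\<one>\<^bsub>P\<^esub> \<ominus>\<^bsub>P\<^esub> t' \<otimes>\<^bsub>P\<^esub> (const a \<otimes>\<^bsub>P\<^esub> (g \<ominus>\<^bsub>P\<^esub> const z))) = \<one>\<^bsub>P\<^esub> \<oplus>\<^bsub>P\<^esub> y"
      using ag t' unfolding J_iff by blast
    have zR: "z \<in> carrier R" using z by simp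
    define k where "k = u \<otimes>\<^bsub>P\<^esub> t' \<otimes>\<^bsub>P\<^esub> const a"
    have k: "k \<in> carrier P" using u t' a by (simp add: k_def)
    have "u \<otimes>\<^bsub>P\<^esub> (\<one>\<^bsub>P\<^esub> \<ominus>\<^bsub>P\<^esub> t' \<otimes>\<^bsub>P\<^esub> (const a \<otimes>\<^bsub>P\<^esub> (g \<ominus>\<^bsub>P\<^esub> const z))) = u \<ominus>\<^bsub>P\<^esub> (k \<otimes>\<^bsub>P\<^esub> g \<ominus>\<^bsub>P\<^esub> k \<otimes>\<^bsub>P\<^esub> const z)"
      using u t' a gc zR by (simp add: k_def P.minus_eq P.r_distr P.r_minus P.m_assoc)
    then have "\<Lambda> u \<ominus>\<^bsub>P\<^esub> (\<Lambda> k \<otimes>\<^bsub>P\<^esub> indet \<ominus>\<^bsub>P\<^esub> \<Lambda> k \<otimes>\<^bsub>P\<^esub> const z) = \<one>\<^bsub>P\<^esub> \<oplus>\<^bsub>P\<^esub> \<Lambda> y"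
      using arg_cong[OF e, of \<Lambda>] u k gc zR y by (simp add: minus add one mult_g mult_const)
    also have "\<Lambda> k = \<Lambda> u \<otimes>\<^bsub>P\<^esub> t \<otimes>\<^bsub>P\<^esub> const a"
      unfolding k_def using u t' a by (simp add: mult_const tt')
    finally have "\<Lambda> u \<otimes>\<^bsub>P\<^esub> (\<one>\<^bsub>P\<^esub> \<ominus>\<^bsub>P\<^esub> t \<otimes>\<^bsub>P\<^esub> (const a \<otimes>\<^bsub>P\<^esub> (indet \<ominus>\<^bsub>P\<^esub> const z))) = \<one>\<^bsub>P\<^esub> \<oplus>\<^bsub>P\<^esub> \<Lambda> y"
      using u t a zR by (simp add: P.minus_eq P.r_distr P.r_minus P.m_assoc)
    moreover have "\<Lambda> y \<in> ?L" unfolding \<Lambda>_def by (rule replace_powers_polys_over[OF c y])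
    ultimately show ?thesis using u by (meson closed)
  qed
  then show ?thesis unfolding J_iff using a z by simp
qed

end

section \<open>Coefficients of elements of the radical\<close>

lemma (in abelian_group) add_minus_add_cancel:
  assumes "x \<in> carrier G" "y \<in> carrier G" "z \<in> carrier G"
  shows "(x \<oplus> y) \<ominus> (x \<oplus> z) = y \<ominus> z"
  unfolding a_comm[OF assms(1,2)] using assms by (simp add: minus_eq minus_add a_assoc r_neg2)

context UP_ring
begin

lemma replace_powers_monom:
  assumes p: "p \<in> carrier P"
  shows "replace_powers (monom P \<one>) p = p"
proof -
  have "replace_powers (monom P \<one>) p = (\<Oplus>\<^bsub>P\<^esub>i\<in>{..deg R p}. monom P (coeff P p i) i)"
    unfolding replace_powers_def
    by (intro P.finsum_cong') (use p monom_mult[OF _ R.one_closed, of _ 0] in \<open>auto simp: Pi_def simp flip: monom_mult\<close>)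
  then show ?thesis using up_repr[OF p] by simp
qed

lemma at_square_finsum:
  assumes "\<And>i. i \<le> n \<Longrightarrow> f i \<in> carrier P"
  shows "at_square (\<Oplus>\<^bsub>P\<^esub>i\<in>{..n}. f i) = (\<Oplus>\<^bsub>P\<^esub>i\<in>{..(n::nat)}. at_square (f i))"
  using assms by (induction n) (simp_all add: Pi_def at_square_add)

end

context UP_left_ideal
begin

text \<open>Write \<open>a g\<close> as \<open>h(g)\<close> with \<open>h = a x\<close>, and also as \<open>h(g - 1)\<close> with \<open>h = a(x + 1)\<close>. Both \<open>a x\<close> and
  \<open>a(x + 1)\<close> are then in the radical, hence so is their difference \<open>a\<close>.\<close>

lemma const_J_of_const_mult_central_monic:
  assumes g: "central_monic d g" and a: "a \<in> carrier R" and ag: "const a \<otimes>\<^bsub>P\<^esub> g \<in> J"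
  shows "const a \<in> J"
proof (cases "d = 0")
  case True
  then have "g = \<one>\<^bsub>P\<^esub>" using central_monic_zero_eq_one g by blast
  then show ?thesis using ag a by simp
next
  case False
  then have d: "d > 0" by simp
  have gc: "g \<in> carrier P" using g by (rule central_monic_closed)
  have 0: "const a \<otimes>\<^bsub>P\<^esub> indet \<in> J"
    using const_mult_indet_minus_J[OF g d R.center_zero a] ag gc a by (simp add: P.minus_eq)
  have g1: "central_monic d (g \<ominus>\<^bsub>P\<^esub> \<one>\<^bsub>P\<^esub>)"
    using central_monic_minus[OF g central_monic_monom[of 0] d] by simp
  have m1: "\<ominus> \<one> \<in> ring_center R"
    using R.center_minus[OF R.center_zero R.center_one] by (simp add: R.minus_eq)
  have "g \<ominus>\<^bsub>P\<^esub> \<one>\<^bsub>P\<^esub> \<ominus>\<^bsub>P\<^esub> const (\<ominus> \<one>) = g"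
    using gc by (simp add: P.minus_eq P.a_assoc P.l_neg)
  then have 1: "const a \<otimes>\<^bsub>P\<^esub> (indet \<ominus>\<^bsub>P\<^esub> const (\<ominus> \<one>)) \<in> J"
    using const_mult_indet_minus_J[OF g1 d m1 a] ag by simp
  have "const a \<otimes>\<^bsub>P\<^esub> (indet \<ominus>\<^bsub>P\<^esub> const (\<ominus> \<one>)) \<ominus>\<^bsub>P\<^esub> const a \<otimes>\<^bsub>P\<^esub> indet = const a"
    using a by (simp add: P.minus_eq P.r_distr P.a_ac P.r_neg P.r_neg2)
  then show ?thesis using J.minus_mem[OF 1 0] by simp
qed

text \<open>Elimination of the last term: for \<open>F = \<Sum> a\<^sub>i g\<^sub>i\<close> and \<open>h\<close> the last of the \<open>g\<^sub>i\<close>, the element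
  \<open>h(x\<^sup>2) F(x) - h(x) F(x\<^sup>2)\<close> of the radical has the same coefficients \<open>a\<^sub>i\<close> except the last, now at
  the polynomials \<open>g\<^sub>i(x) h(x\<^sup>2) - h(x) g\<^sub>i(x\<^sup>2)\<close>. The first of the two products has the larger
  degree because \<open>deg g\<^sub>i < deg h\<close>, so these polynomials are again central and monic with
  increasing degrees. Induction needs families of this generality: starting from the powers of
  \<open>x\<close>, one step already leaves the powers. The remaining coefficient is found by subtracting the
  terms that are known to lie in the radical.\<close>

lemma const_J_of_central_monic_combination:
  fixes n :: nat
  assumes "\<And>i. i \<le> n \<Longrightarrow> central_monic (d i) (g i)"
    and "\<And>i j. i < j \<Longrightarrow> j \<le> n \<Longrightarrow> d i < d j"
    and "\<And>i. i \<le> n \<Longrightarrow> a i \<in> carrier R"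
    and "(\<Oplus>\<^bsub>P\<^esub>i\<in>{..n}. const (a i) \<otimes>\<^bsub>P\<^esub> g i) \<in> J"
    and "i \<le> n"
  shows "const (a i) \<in> J"
  using assms
proof (induction n arbitrary: d g i)
  case 0
  then show ?case
    using const_J_of_const_mult_central_monic[of "d 0" "g 0" "a 0"] central_monic_closed[of "d 0" "g 0"]
    by (simp add: Pi_def)
next
  case (Suc n)
  define h where "h = g (Suc n)"
  define b where "b = const (a (Suc n))"
  have h: "central_monic (d (Suc n)) h" using Suc.prems(1) by (simp add: h_def)
  have hz: "h \<in> ring_center P" "at_square h \<in> ring_center P"
    using central_monic_center[OF h] at_square_center by blast+
  have hc: "h \<in> carrier P" using hz(1) by simp
  have ac [simp]: "const (a i) \<in> carrier P" if "i \<le> Suc n" for i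
    using Suc.prems(3)[OF that] by simp
  have bc: "b \<in> carrier P" by (simp add: b_def)
  have gz: "g i \<in> ring_center P" if "i \<le> Suc n" for i
    using central_monic_center[OF Suc.prems(1)[OF that]] .
  have gc [simp]: "g i \<in> carrier P" if "i \<le> Suc n" for i
    using gz[OF that] by simp
  define F where "F = (\<Oplus>\<^bsub>P\<^esub>i\<in>{..Suc n}. const (a i) \<otimes>\<^bsub>P\<^esub> g i)"
  define S where "S = (\<Oplus>\<^bsub>P\<^esub>i\<in>{..n}. const (a i) \<otimes>\<^bsub>P\<^esub> g i)"
  have S: "S \<in> carrier P" by (simp add: S_def Pi_def)
  have F: "F = b \<otimes>\<^bsub>P\<^esub> h \<oplus>\<^bsub>P\<^esub> S"
    unfolding F_def S_def b_def h_def by (subst P.finsum_Suc) (simp_all add: Pi_def)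
  have FJ: "F \<in> J" using Suc.prems(4) by (simp add: F_def)
  have sqS: "at_square S = (\<Oplus>\<^bsub>P\<^esub>i\<in>{..n}. const (a i) \<otimes>\<^bsub>P\<^esub> at_square (g i))"
    unfolding S_def using Suc.prems(3)
    by (subst at_square_finsum) (auto intro!: P.finsum_cong' simp: at_square_mult at_square_const Pi_def)
  have sqb: "at_square b = b" using Suc.prems(3) by (simp add: b_def at_square_const)
  let ?g = "\<lambda>i. g i \<otimes>\<^bsub>P\<^esub> at_square h \<ominus>\<^bsub>P\<^esub> h \<otimes>\<^bsub>P\<^esub> at_square (g i)"
  have sum: "(\<Oplus>\<^bsub>P\<^esub>i\<in>{..n}. const (a i) \<otimes>\<^bsub>P\<^esub> ?g i) = at_square h \<otimes>\<^bsub>P\<^esub> F \<ominus>\<^bsub>P\<^esub> h \<otimes>\<^bsub>P\<^esub> at_square F"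
  proof -
    have "const (a i) \<otimes>\<^bsub>P\<^esub> ?g i \<oplus>\<^bsub>P\<^esub> h \<otimes>\<^bsub>P\<^esub> (const (a i) \<otimes>\<^bsub>P\<^esub> at_square (g i))
        = at_square h \<otimes>\<^bsub>P\<^esub> (const (a i) \<otimes>\<^bsub>P\<^esub> g i)" if "i \<le> n" for i
    proof -
      have c: "const (a i) \<in> carrier P" "g i \<in> carrier P" using that by simp_all
      have "h \<otimes>\<^bsub>P\<^esub> (const (a i) \<otimes>\<^bsub>P\<^esub> at_square (g i)) = const (a i) \<otimes>\<^bsub>P\<^esub> (h \<otimes>\<^bsub>P\<^esub> at_square (g i))"
        using c hc P.center_comm[OF hz(1) c(1)] by (simp flip: P.m_assoc)
      moreover have "at_square h \<otimes>\<^bsub>P\<^esub> (const (a i) \<otimes>\<^bsub>P\<^esub> g i) = const (a i) \<otimes>\<^bsub>P\<^esub> (g i \<otimes>\<^bsub>P\<^esub> at_square h)"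
        using c hc P.center_comm[OF hz(2), of "const (a i) \<otimes>\<^bsub>P\<^esub> g i"] by (simp add: P.m_assoc)
      ultimately show ?thesis
        using c hc by (simp add: P.r_distr P.minus_eq P.r_minus P.a_assoc P.l_neg)
    qed
    then have "(\<Oplus>\<^bsub>P\<^esub>i\<in>{..n}. const (a i) \<otimes>\<^bsub>P\<^esub> ?g i \<oplus>\<^bsub>P\<^esub> h \<otimes>\<^bsub>P\<^esub> (const (a i) \<otimes>\<^bsub>P\<^esub> at_square (g i)))
        = (\<Oplus>\<^bsub>P\<^esub>i\<in>{..n}. at_square h \<otimes>\<^bsub>P\<^esub> (const (a i) \<otimes>\<^bsub>P\<^esub> g i))"
      using hc by (intro P.finsum_cong') (simp_all add: Pi_def)
    then have "(\<Oplus>\<^bsub>P\<^esub>i\<in>{..n}. const (a i) \<otimes>\<^bsub>P\<^esub> ?g i) \<oplus>\<^bsub>P\<^esub> h \<otimes>\<^bsub>P\<^esub> at_square S = at_square h \<otimes>\<^bsub>P\<^esub> S"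
      unfolding sqS unfolding S_def using hc
      by (simp add: P.finsum_addf P.finsum_rdistr Pi_def)
    moreover have "(\<Oplus>\<^bsub>P\<^esub>i\<in>{..n}. const (a i) \<otimes>\<^bsub>P\<^esub> ?g i) \<in> carrier P"
      using hc by (simp add: Pi_def)
    ultimately have e: "(\<Oplus>\<^bsub>P\<^esub>i\<in>{..n}. const (a i) \<otimes>\<^bsub>P\<^esub> ?g i) = at_square h \<otimes>\<^bsub>P\<^esub> S \<ominus>\<^bsub>P\<^esub> h \<otimes>\<^bsub>P\<^esub> at_square S"
      using hc S by (simp add: P.minus_eq P.a_assoc P.r_neg flip: \<open>_ = at_square h \<otimes>\<^bsub>P\<^esub> S\<close>)
    have "at_square h \<otimes>\<^bsub>P\<^esub> (b \<otimes>\<^bsub>P\<^esub> h) = b \<otimes>\<^bsub>P\<^esub> (h \<otimes>\<^bsub>P\<^esub> at_square h)"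
      using bc hc P.center_comm[OF hz(2), of "b \<otimes>\<^bsub>P\<^esub> h"] by (simp add: P.m_assoc)
    also have "\<dots> = h \<otimes>\<^bsub>P\<^esub> (b \<otimes>\<^bsub>P\<^esub> at_square h)"
      using bc hc P.center_comm[OF hz(1) bc] by (simp flip: P.m_assoc)
    finally have "at_square h \<otimes>\<^bsub>P\<^esub> (b \<otimes>\<^bsub>P\<^esub> h) = h \<otimes>\<^bsub>P\<^esub> (b \<otimes>\<^bsub>P\<^esub> at_square h)" .
    then show ?thesis
      unfolding e F using bc hc S
      by (simp add: at_square_add at_square_mult sqb P.r_distr P.add_minus_add_cancel)
  qed
  have low: "const (a i) \<in> J" if i: "i \<le> n" for i
  proof (rule Suc.IH[where g = ?g and d = "\<lambda>i. d i + 2 * d (Suc n)"])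
    show "central_monic (d i + 2 * d (Suc n)) (?g i)" if "i \<le> n" for i
    proof (rule central_monic_minus)
      have m: "central_monic (d i) (g i)" using Suc.prems(1) that by simp
      show "central_monic (d i + 2 * d (Suc n)) (g i \<otimes>\<^bsub>P\<^esub> at_square h)"
        by (intro central_monic_mult m central_monic_at_square h)
      show "central_monic (d (Suc n) + 2 * d i) (h \<otimes>\<^bsub>P\<^esub> at_square (g i))"
        by (intro central_monic_mult m central_monic_at_square h)
      show "d (Suc n) + 2 * d i < d i + 2 * d (Suc n)"
        using Suc.prems(2)[of i "Suc n"] that by simp
    qed
    show "d i + 2 * d (Suc n) < d j + 2 * d (Suc n)" if "i < j" "j \<le> n" for i j
      using Suc.prems(2)[of i j] that by simp
    show "a i \<in> carrier R" if "i \<le> n" for i using Suc.prems(3) that by simp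
    have "at_square h \<otimes>\<^bsub>P\<^esub> F \<ominus>\<^bsub>P\<^esub> h \<otimes>\<^bsub>P\<^esub> at_square F \<in> J"
      using hc by (intro J.minus_mem J.left_closed at_square_J FJ) simp_all
    then show "(\<Oplus>\<^bsub>P\<^esub>i\<in>{..n}. const (a i) \<otimes>\<^bsub>P\<^esub> ?g i) \<in> J" by (simp only: sum)
  qed (rule i)
  show ?case
  proof (cases "i = Suc n")
    case True
    have "const (a i) \<otimes>\<^bsub>P\<^esub> g i \<in> J" if "i \<le> n" for i
      using J.left_closed[OF low[OF that], of "g i"] P.center_comm[OF gz, of i "const (a i)"] that
      by simp
    then have "S \<in> J" unfolding S_def by (intro J.finsum_mem) simp_all
    then have "F \<ominus>\<^bsub>P\<^esub> S \<in> J" by (rule J.minus_mem[OF FJ])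
    moreover have "F \<ominus>\<^bsub>P\<^esub> S = const (a i) \<otimes>\<^bsub>P\<^esub> h"
      unfolding F True b_def using S hc ac[of "Suc n"] by (simp add: P.minus_eq P.a_assoc P.r_neg)
    ultimately show ?thesis
      using const_J_of_const_mult_central_monic[OF h Suc.prems(3)] True by simp
  next
    case False
    then show ?thesis using low Suc.prems(5) by simp
  qed
qed

lemma mem_constants_J: "a \<in> constants_in R J \<longleftrightarrow> a \<in> carrier R \<and> const a \<in> J"
  by (simp add: constants_in_def P_def)

lemma J_eq_polys_over: "J = polys_over R (constants_in R J)"
proof (intro equalityI subsetI)
  fix p assume p: "p \<in> J"
  have pc: "p \<in> carrier P" using p by simp
  have "const (coeff P p n) \<in> J" for n
  proof (cases "n \<le> deg R p")
    case True
    show ?thesis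
    proof (rule const_J_of_central_monic_combination[OF _ _ _ _ True])
      show "(\<Oplus>\<^bsub>P\<^esub>i\<in>{..deg R p}. const (coeff P p i) \<otimes>\<^bsub>P\<^esub> monom P \<one> i) \<in> J"
        using p replace_powers_monom[OF pc] by (simp add: replace_powers_def)
    qed (use pc in \<open>simp_all add: central_monic_monom\<close>)
  next
    case False
    then show ?thesis
      using additive_subgroup.zero_closed[OF J.is_additive_subgroup] pc by (simp add: deg_aboveD)
  qed
  then show "p \<in> polys_over R (constants_in R J)"
    using pc coeff_closed[OF pc] unfolding mem_polys_over mem_constants_J by blast
next
  fix p assume "p \<in> polys_over R (constants_in R J)"
  then have pc: "p \<in> carrier P" and cp: "\<And>n. const (coeff P p n) \<in> J"
    unfolding mem_polys_over mem_constants_J by blast+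
  have "replace_powers (monom P \<one>) p \<in> J"
    by (rule replace_powers_in_left_ideal[OF left_ideal_J indet_power_center cp])
  then show "p \<in> J" using replace_powers_monom[OF pc] by simp
qed

text \<open>Testing \<open>a \<in> J\<close> against \<open>t = x\<close> gives \<open>u (1 - x a) = 1 + y\<close> with \<open>y \<in> I[x]\<close>. The coefficients
  of \<open>u\<close> then satisfy \<open>u\<^sub>n = u\<^sub>n\<^sub>-\<^sub>1 a + y\<^sub>n\<close>, so Horner's scheme gives
  \<open>u\<^sub>n = a^n + \<Sum>i\<le>n. y\<^sub>n\<^sub>-\<^sub>i a^i\<close>, which vanishes for large \<open>n\<close>.\<close>

lemma integral_elem_of_const_J:
  assumes a: "a \<in> carrier R" and aJ: "const a \<in> J"
  shows "integral_elem R I a"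
proof -
  obtain u y where u: "u \<in> carrier P" and y: "y \<in> polys_over R I"
    and e: "u \<otimes>\<^bsub>P\<^esub> (\<one>\<^bsub>P\<^esub> \<ominus>\<^bsub>P\<^esub> indet \<otimes>\<^bsub>P\<^esub> const a) = \<one>\<^bsub>P\<^esub> \<oplus>\<^bsub>P\<^esub> y"
    using bspec[OF conjunct2[OF aJ[unfolded J_iff]] indet_closed] by blast
  have yc: "y \<in> carrier P" and yI: "coeff P y n \<in> I" for n
    using y unfolding mem_polys_over by blast+
  have "u \<otimes>\<^bsub>P\<^esub> (\<one>\<^bsub>P\<^esub> \<ominus>\<^bsub>P\<^esub> indet \<otimes>\<^bsub>P\<^esub> const a) = u \<ominus>\<^bsub>P\<^esub> u \<otimes>\<^bsub>P\<^esub> indet \<otimes>\<^bsub>P\<^esub> const a"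
    using u a by (simp add: P.minus_eq P.r_distr P.r_minus P.m_assoc)
  then have "u = \<one>\<^bsub>P\<^esub> \<oplus>\<^bsub>P\<^esub> y \<oplus>\<^bsub>P\<^esub> u \<otimes>\<^bsub>P\<^esub> indet \<otimes>\<^bsub>P\<^esub> const a"
    using u a yc e by (simp add: P.minus_eq P.a_assoc P.l_neg flip: e)
  then have cu: "coeff P u n = coeff P (\<one>\<^bsub>P\<^esub> \<oplus>\<^bsub>P\<^esub> y \<oplus>\<^bsub>P\<^esub> u \<otimes>\<^bsub>P\<^esub> indet \<otimes>\<^bsub>P\<^esub> const a) n" for n
    by (rule arg_cong)
  have horner: "coeff P u n = a [^] n \<oplus> (\<Oplus>i\<in>{..n}. coeff P y (n - i) \<otimes> a [^] i)" for n
  proof (induction n)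
    case 0
    then show ?case
      using cu[of 0] u yc a by (simp add: coeff_mult_const coeff_mult_indet del: coeff_mult)
  next
    case (Suc n)
    let ?f = "\<lambda>m i. coeff P y (m - i) \<otimes> a [^] (i::nat)"
    have "coeff P u (Suc n) = coeff P y (Suc n) \<oplus> coeff P u n \<otimes> a"
      using cu[of "Suc n"] u yc a by (simp add: coeff_mult_const coeff_mult_indet del: coeff_mult)
    also have "coeff P u n \<otimes> a = a [^] Suc n \<oplus> (\<Oplus>i\<in>{..n}. ?f n i \<otimes> a)"
      unfolding Suc.IH using yc a by (simp add: R.l_distr R.finsum_ldistr Pi_def)
    also have "(\<Oplus>i\<in>{..n}. ?f n i \<otimes> a) = (\<Oplus>i\<in>{..n}. ?f (Suc n) (Suc i))"
      using yc a by (intro R.finsum_cong') (simp_all add: Pi_def R.m_assoc)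
    also have "coeff P y (Suc n) \<oplus> (a [^] Suc n \<oplus> (\<Oplus>i\<in>{..n}. ?f (Suc n) (Suc i)))
        = a [^] Suc n \<oplus> ((\<Oplus>i\<in>{..n}. ?f (Suc n) (Suc i)) \<oplus> ?f (Suc n) 0)"
      using yc a by (simp add: R.a_ac Pi_def)
    also have "(\<Oplus>i\<in>{..n}. ?f (Suc n) (Suc i)) \<oplus> ?f (Suc n) 0 = (\<Oplus>i\<in>{..Suc n}. ?f (Suc n) i)"
      using yc a by (intro R.finsum_Suc2[symmetric]) (simp add: Pi_def)
    finally show ?case .
  qed
  define n where "n = Suc (deg R u)"
  \<comment> \<open>The relation for \<open>u\<^sub>n\<close> contains \<open>y\<^sub>0 a^n\<close> next to \<open>a^n\<close>, so its leading coefficient is \<open>1 + y\<^sub>0\<close>.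
  Multiplying by \<open>a\<close> from the left makes it monic of degree \<open>n + 1\<close>, with coefficients in the left
  ideal \<open>I\<close>.\<close>
  define r where "r i = a \<otimes> coeff P y (n - i)" for i
  have rI: "r i \<in> I" for i unfolding r_def by (rule I.left_closed[OF yI a])
  have "coeff P u n = \<zero>" using u by (intro deg_aboveD) (simp_all add: n_def)
  then have "\<zero> = a \<otimes> (a [^] n \<oplus> (\<Oplus>i\<in>{..n}. coeff P y (n - i) \<otimes> a [^] i))"
    unfolding horner using a by simp
  also have "\<dots> = a \<otimes> a [^] n \<oplus> (\<Oplus>i\<in>{..n}. a \<otimes> (coeff P y (n - i) \<otimes> a [^] i))"
    using a yc by (simp add: R.r_distr R.finsum_rdistr Pi_def)
  also have "(\<Oplus>i\<in>{..n}. a \<otimes> (coeff P y (n - i) \<otimes> a [^] i)) = (\<Oplus>i\<in>{..<Suc n}. r i \<otimes> a [^] i)"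
    using a yc by (intro R.finsum_cong') (auto simp: Pi_def r_def R.m_assoc)
  also have "a \<otimes> a [^] n = a [^] Suc n" using a by (rule R.nat_pow_Suc2[symmetric])
  finally have "a [^] Suc n \<oplus> (\<Oplus>i\<in>{..<Suc n}. r i \<otimes> a [^] i) = \<zero>" ..
  then show ?thesis
    unfolding integral_elem_def using rI by (intro exI[of _ "Suc n"] conjI exI[of _ r]) simp_all
qed

end

theorem theorem4p12:
  fixes R :: "('a, 'm) ring_scheme" and I :: "'a set"
  assumes "ring R"
    and "left_ideal I R"
  shows "j_radical (UP R) (polys_over R I)
           = polys_over R (constants_in R (j_radical (UP R) (polys_over R I)))
         \<and> integral_over R I (constants_in R (j_radical (UP R) (polys_over R I)))"
proof -
  interpret R: ring R by (rule assms(1))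
  interpret R: left_ideal I R by (rule assms(2))
  interpret UP_left_ideal R "UP R" I
    by unfold_locales
  have "integral_over R I (constants_in R J)"
    unfolding integral_over_def
    using mem_constants_J integral_elem_of_const_J by blast
  then show ?thesis
    using J_eq_polys_over by (simp add: J_def)
qed

end
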